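(* Let $X$ be a compact metric space, let $T\colon X\to X$ be a continuous mapping, and let $X_0$ be the ergodic support of the dynamical system $(X,T)$. Then for every $T$-invariant Borel probability measure $\mu\in M_T(X)$ we have $\mu(X_0)=1$.
   Context: $M(X)$ is the set of all Borel probability measures on $X$, equipped with the weak topology generated by continuous functions (i.e. $\mu_n\to\mu$ iff $\int_X f\,d\mu_n\to\int_X f\,d\mu$ for all $f\in C(X)$). $M_T(X)\subset M(X)$ is the subset of $T$-invariant measures, and $\mathrm{Erg}\,X\subset M_T(X)$ is the set of ergodic measures of $(X,T)$. For $x\in X$ and $n\ge 1$ the empirical measure is $\delta_{x,n}=\frac1n(\delta_x+\delta_{Tx}+\dots+\delta_{T^{n-1}x})$, where $\delta_x$ is the unit mass at $x$. For $\mu\in M_T(X)$ its basin is $B(\mu)=\{x\in X:\ \delta_{x,n}\to\mu \text{ weakly as } n\to\infty\}$. The ergodic support of $(X,T)$ is $X_0=\bigcup\{B(\mu):\mu\in\mathrm{Erg}\,X\}$, i.e. the set of all $x\in X$ such that $\delta_{x,n}$ converges weakly to some ergodic measure. *)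

theory Defs
  imports "HOL-Probability.Probability"
begin

definition borel_prob_measures :: "'a::topological_space measure set" where
  "borel_prob_measures = {\<mu>. prob_space \<mu> \<and> sets \<mu> = sets borel}"

definition invariant_measures :: "('a::topological_space \<Rightarrow> 'a) \<Rightarrow> 'a measure set" where
  "invariant_measures T =
     {\<mu> \<in> borel_prob_measures. \<forall>A\<in>sets borel. emeasure \<mu> (T -` A) = emeasure \<mu> A}"

definition ergodic_measures :: "('a::topological_space \<Rightarrow> 'a) \<Rightarrow> 'a measure set" where
  "ergodic_measures T =
     {\<mu> \<in> invariant_measures T.
        \<forall>A\<in>sets borel. T -` A = A \<longrightarrow> emeasure \<mu> A = 0 \<or> emeasure \<mu> A = 1}"

text \<open>Convergence in the weak topology generated by all continuous real functions. This is meant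
  for compact spaces, where such functions are automatically bounded, hence integrable.\<close>

definition weakly_converges ::
    "(nat \<Rightarrow> 'a::topological_space measure) \<Rightarrow> 'a measure \<Rightarrow> bool" where
  "weakly_converges M \<mu> \<longleftrightarrow>
     (\<forall>f :: 'a \<Rightarrow> real. continuous_on UNIV f \<longrightarrow>
        (\<lambda>n. \<integral>x. f x \<partial>(M n)) \<longlonglongrightarrow> (\<integral>x. f x \<partial>\<mu>))"

text \<open>The library's \<^const>\<open>return\<close> is the unit mass at a point. For \<open>n = 0\<close> the definition below gives
  the null measure, which is irrelevant for limits as \<open>n\<close> tends to infinity.\<close>

definition empirical_measure ::
    "('a::topological_space \<Rightarrow> 'a) \<Rightarrow> 'a \<Rightarrow> nat \<Rightarrow> 'a measure" where
  "empirical_measure T x n =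
     measure_of UNIV (sets borel)
       (\<lambda>A. ennreal (1 / real n) * (\<Sum>k<n. emeasure (return borel ((T ^^ k) x)) A))"

lemma sets_empirical_measure [simp, measurable_cong]:
  "sets (empirical_measure T x n) = sets borel"
  unfolding empirical_measure_def
  by (metis sets.sets_measure_of_eq space_borel)

text \<open>\<^const>\<open>measure_of\<close> yields the null measure unless the given set function is countably additive
  and nonnegative; the next lemma shows that it is.\<close>

lemma emeasure_empirical_measure:
  assumes "A \<in> sets borel"
  shows "emeasure (empirical_measure T x n) A =
    ennreal (1 / real n) * (\<Sum>k<n. emeasure (return borel ((T ^^ k) x)) A)"
proof (rule emeasure_measure_of[OF empirical_measure_def])
  show "sets borel \<subseteq> Pow (UNIV :: 'a set)" by simp
  show "A \<in> sets (empirical_measure T x n)" using assms by simp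
  show "positive (sets (empirical_measure T x n))
     (\<lambda>A. ennreal (1 / real n) * (\<Sum>k<n. emeasure (return borel ((T ^^ k) x)) A))"
    by (simp add: positive_def)
  show "countably_additive (sets (empirical_measure T x n))
     (\<lambda>A. ennreal (1 / real n) * (\<Sum>k<n. emeasure (return borel ((T ^^ k) x)) A))"
  proof (rule countably_additiveI)
    fix B :: "nat \<Rightarrow> 'a set"
    assume B: "range B \<subseteq> sets (empirical_measure T x n)" "disjoint_family B"
    have "(\<Sum>i. \<Sum>k<n. emeasure (return borel ((T ^^ k) x)) (B i)) =
        (\<Sum>k<n. \<Sum>i. emeasure (return borel ((T ^^ k) x)) (B i))"
      by (intro suminf_sum summableI)
    also have "\<dots> = (\<Sum>k<n. emeasure (return borel ((T ^^ k) x)) (\<Union>i. B i))"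
      using B by (intro sum.cong refl suminf_emeasure) auto
    finally show "(\<Sum>i. ennreal (1 / real n) *
          (\<Sum>k<n. emeasure (return borel ((T ^^ k) x)) (B i))) =
        ennreal (1 / real n) * (\<Sum>k<n. emeasure (return borel ((T ^^ k) x)) (\<Union>i. B i))"
      by (simp add: ennreal_suminf_cmult)
  qed
qed

definition basin :: "('a::topological_space \<Rightarrow> 'a) \<Rightarrow> 'a measure \<Rightarrow> 'a set" where
  "basin T \<mu> = {x. weakly_converges (empirical_measure T x) \<mu>}"

definition ergodic_support :: "('a::topological_space \<Rightarrow> 'a) \<Rightarrow> 'a set" where
  "ergodic_support T = (\<Union>\<mu>\<in>ergodic_measures T. basin T \<mu>)"

end

theory Submission
  imports Defs
begin

text \<open>
  By Birkhoff's theorem, for almost every \<open>x\<close> the averages \<open>A\<^sub>n f(x)\<close> of every \<open>f\<close> in a countable dense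
  set of continuous functions converge, hence those of all continuous functions do; by Riesz, the
  limit functional is an invariant measure \<open>\<nu>\<close>. An invariant measure \<open>\<nu>\<close> is ergodic if and only if the
  variance of \<open>A\<^sub>m f\<close> under \<open>\<nu>\<close> becomes arbitrarily small for all \<open>f\<close> in the dense set. Since \<open>(A\<^sub>m f)\<^sup>2\<close> is
  continuous, this variance is again a limit of averages at \<open>x\<close>. So the ergodic support is the Borel set
  of points at which countably many explicit limit conditions hold, and the conditions hold almost
  everywhere because \<open>A\<^sub>m f\<close> converges in \<open>L\<^sup>2(\<mu>)\<close>.
\<close>

section \<open>Birkhoff's ergodic theorem\<close>

text \<open>The exceptional null set has to be fixed before any limit measure \<nu> is known, since
  \<nu> varies with the point. Ergodicity itself cannot be read off a weak limit: it quantifies over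
  all invariant Borel sets, whose indicators are in general not continuous. Variances of averages
  decide it for the following reason. The averages of f tend to an invariant function F, and by
  dominated convergence their second moments tend to that of F. If \<nu> is ergodic, F is constant
  and the limiting variance is zero. Conversely, an invariant set has the same covariance with f as
  with every average of f, so by Cauchy-Schwarz this covariance is zero once the variances come
  arbitrarily close to zero. The test succeeds at \<mu>-almost every point, although \<mu> need not
  be ergodic, because it compares with the square of F(x) and not with the squared \<mu>-integral of
  f: the limit at x of the averages of the squared A_m f is almost everywhere at least the square of
  F(x), and its integral tends to the integral of the square of F.\<close>

definition birkhoff_average :: "('a \<Rightarrow> 'a) \<Rightarrow> ('a \<Rightarrow> real) \<Rightarrow> nat \<Rightarrow> 'a \<Rightarrow> real" where
  "birkhoff_average T f n x = (\<Sum>k<n. f ((T ^^ k) x)) / real n"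

text \<open>The upper limit makes the function defined and measurable everywhere, whether or not the
  averages converge. For bounded \<open>f\<close> it is finite, so nothing is lost in passing from
  \<open>ereal\<close> to the reals.\<close>

definition birkhoff_limit :: "('a \<Rightarrow> 'a) \<Rightarrow> ('a \<Rightarrow> real) \<Rightarrow> 'a \<Rightarrow> real" where
  "birkhoff_limit T f x = real_of_ereal (limsup (\<lambda>n. ereal (birkhoff_average T f n x)))"

section \<open>Elementary properties of Birkhoff averages and their upper limits\<close>

lemma birkhoff_average_bounded:
  assumes "\<And>x. \<bar>f x\<bar> \<le> B"
  shows "\<bar>birkhoff_average T f n x\<bar> \<le> B"
proof (cases "n = 0")
  case True
  then show ?thesis using assms[of x] by (simp add: birkhoff_average_def)
next
  case False
  have "\<bar>\<Sum>k<n. f ((T ^^ k) x)\<bar> \<le> (\<Sum>k<n. \<bar>f ((T ^^ k) x)\<bar>)" by (rule sum_abs)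
  also have "\<dots> \<le> real n * B" using sum_bounded_above[of "{..<n}" "\<lambda>k. \<bar>f ((T ^^ k) x)\<bar>" B] assms by simp
  finally show ?thesis using False
    by (simp add: birkhoff_average_def abs_divide divide_le_eq mult.commute)
qed

text \<open>The two orbit segments differ only in their end points. For \<open>n = 0\<close> both
  sides are 0, because division by zero gives 0.\<close>

lemma birkhoff_average_shift:
  "birkhoff_average T f n (T x) = birkhoff_average T f n x + (f ((T ^^ n) x) - f x) / real n"
proof -
  have "(\<Sum>k<n. f ((T ^^ k) (T x))) = (\<Sum>k<Suc n. f ((T ^^ k) x)) - f x"
    by (subst sum.lessThan_Suc_shift) (simp add: funpow_swap1)
  then show ?thesis
    by (simp add: birkhoff_average_def add_divide_distrib diff_divide_distrib)
qed

lemma birkhoff_average_shift_diff: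
  assumes "\<And>x. \<bar>f x\<bar> \<le> B"
  shows "(\<lambda>n. (f ((T ^^ n) x) - f x) / real n) \<longlonglongrightarrow> 0"
proof (rule Lim_null_comparison)
  show "\<forall>\<^sub>F n in sequentially. norm ((f ((T ^^ n) x) - f x) / real n) \<le> 2 * B / real n"
  proof (intro always_eventually allI)
    fix n
    have "\<bar>f ((T ^^ n) x) - f x\<bar> \<le> 2 * B" using assms[of x] assms[of "(T ^^ n) x"] by linarith
    then show "norm ((f ((T ^^ n) x) - f x) / real n) \<le> 2 * B / real n"
      by (simp add: abs_divide divide_right_mono)
  qed
  show "(\<lambda>n. 2 * B / real n) \<longlonglongrightarrow> 0" by (rule lim_const_over_n)
qed

lemma birkhoff_average_shift_tendsto:
  assumes "\<And>x. \<bar>f x\<bar> \<le> B" "(\<lambda>n. birkhoff_average T f n x) \<longlonglongrightarrow> c"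
  shows "(\<lambda>n. birkhoff_average T f n ((T ^^ k) x)) \<longlonglongrightarrow> c"
proof (induction k)
  case (Suc k)
  show ?case
    using tendsto_add[OF Suc birkhoff_average_shift_diff[where f=f and T=T and x="(T ^^ k) x", OF assms(1)]]
    by (simp add: birkhoff_average_shift)
qed (use assms in simp)

lemma birkhoff_average_add:
  "birkhoff_average T (\<lambda>x. f x + g x) n x = birkhoff_average T f n x + birkhoff_average T g n x"
  by (simp add: birkhoff_average_def sum.distrib add_divide_distrib)

lemma birkhoff_average_cmult:
  "birkhoff_average T (\<lambda>x. c * f x) n x = c * birkhoff_average T f n x"
  by (simp add: birkhoff_average_def sum_distrib_left)

lemma birkhoff_average_const:
  "n > 0 \<Longrightarrow> birkhoff_average T (\<lambda>x. c) n x = c"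
  by (simp add: birkhoff_average_def)

lemma birkhoff_average_mono:
  "(\<And>x. f x \<le> g x) \<Longrightarrow> birkhoff_average T f n x \<le> birkhoff_average T g n x"
  by (simp add: birkhoff_average_def divide_right_mono sum_mono)

text \<open>Exchanging the two sums leaves a mean over finitely many starting points on one orbit.
  Averages from all of these have the same limit, so averaging \<open>f\<close> beforehand does not
  change the limit.\<close>

lemma birkhoff_average_average:
  "birkhoff_average T (birkhoff_average T f m) n x =
    (\<Sum>j<m. birkhoff_average T f n ((T ^^ j) x)) / real m"
proof -
  have "(\<Sum>k<n. \<Sum>j<m. f ((T ^^ j) ((T ^^ k) x))) = (\<Sum>j<m. \<Sum>k<n. f ((T ^^ k) ((T ^^ j) x)))"
    by (subst sum.swap) (intro sum.cong refl arg_cong[of _ _ f], metis add.commute comp_apply funpow_add)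
  then show ?thesis
    by (simp add: birkhoff_average_def sum_divide_distrib[symmetric] mult.commute)
qed

lemma birkhoff_average_average_tendsto:
  assumes "\<And>x. \<bar>f x\<bar> \<le> B" "(\<lambda>n. birkhoff_average T f n x) \<longlonglongrightarrow> c" "m > 0"
  shows "(\<lambda>n. birkhoff_average T (birkhoff_average T f m) n x) \<longlonglongrightarrow> c"
proof -
  have "(\<lambda>n. (\<Sum>j<m. birkhoff_average T f n ((T ^^ j) x)) / real m) \<longlonglongrightarrow> (\<Sum>j<m. c) / real m"
    using assms by (intro tendsto_divide tendsto_sum birkhoff_average_shift_tendsto tendsto_const) auto
  with \<open>m > 0\<close> show ?thesis by (simp add: birkhoff_average_average)
qed

lemma birkhoff_limit_eq:
  assumes "(\<lambda>n. birkhoff_average T f n x) \<longlonglongrightarrow> c"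
  shows "birkhoff_limit T f x = c"
proof -
  have "limsup (\<lambda>n. ereal (birkhoff_average T f n x)) = ereal c"
    using assms by (intro lim_imp_Limsup) auto
  then show ?thesis by (simp add: birkhoff_limit_def)
qed

lemma limsup_birkhoff_average:
  assumes "\<And>x. \<bar>f x\<bar> \<le> B"
  shows "limsup (\<lambda>n. ereal (birkhoff_average T f n x)) = ereal (birkhoff_limit T f x)"
    and "\<bar>birkhoff_limit T f x\<bar> \<le> B"
proof -
  let ?L = "limsup (\<lambda>n. ereal (birkhoff_average T f n x))"
  have *: "\<bar>birkhoff_average T f n x\<bar> \<le> B" for n by (rule birkhoff_average_bounded[OF assms])
  have 1: "?L \<le> ereal B"
    using * by (intro Limsup_bounded always_eventually) (auto simp: abs_le_iff)
  have "ereal (- B) \<le> liminf (\<lambda>n. ereal (birkhoff_average T f n x))"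
    using * by (intro Liminf_bounded always_eventually) (auto simp: abs_le_iff minus_le_iff)
  then have 2: "ereal (- B) \<le> ?L"
    by (rule order_trans) (simp add: Liminf_le_Limsup)
  from 1 2 show "?L = ereal (birkhoff_limit T f x)" "\<bar>birkhoff_limit T f x\<bar> \<le> B"
    by (cases ?L; simp add: birkhoff_limit_def abs_le_iff)+
qed

text \<open>Adding a null sequence does not change an upper limit, so invariance holds at every
  point and not just almost everywhere. Superlevel sets are therefore exactly invariant, as
  \<open>ergodic_measures\<close> demands of its test sets.\<close>

lemma birkhoff_limit_invariant:
  assumes "\<And>x. \<bar>f x\<bar> \<le> B"
  shows "birkhoff_limit T f (T x) = birkhoff_limit T f x"
proof -
  have "limsup (\<lambda>n. ereal ((f ((T ^^ n) x) - f x) / real n) + ereal (birkhoff_average T f n x)) =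
    ereal 0 + limsup (\<lambda>n. ereal (birkhoff_average T f n x))"
    using birkhoff_average_shift_diff[OF assms]
    by (intro ereal_limsup_lim_add) (auto intro: tendsto_ereal)
  then show ?thesis
    by (simp add: birkhoff_limit_def birkhoff_average_shift add.commute zero_ereal_def[symmetric])
qed

lemma birkhoff_limit_invariant_funpow:
  assumes "\<And>x. \<bar>f x\<bar> \<le> B"
  shows "birkhoff_limit T f ((T ^^ k) x) = birkhoff_limit T f x"
  by (induction k) (auto simp: birkhoff_limit_invariant[where f=f, OF assms])

text \<open>This is the maximum over \<open>n \<le> N\<close> of the sums of \<open>g\<close> along
  the first \<open>n\<close> orbit points, the empty sum included. The recursion splits off the
  first orbit point, which is the form that the maximal inequality needs.\<close>

fun maximal_sum :: "('a \<Rightarrow> 'a) \<Rightarrow> ('a \<Rightarrow> real) \<Rightarrow> nat \<Rightarrow> 'a \<Rightarrow> real" where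
  "maximal_sum T g 0 x = 0"
| "maximal_sum T g (Suc N) x = max 0 (g x + maximal_sum T g N (T x))"

lemma maximal_sum_nonneg: "0 \<le> maximal_sum T g N x"
  by (cases N) auto

lemma maximal_sum_Suc_mono: "maximal_sum T g N x \<le> maximal_sum T g (Suc N) x"
proof (induction N arbitrary: x)
  case (Suc N)
  show ?case using Suc[of "T x"] by (subst (1 2) maximal_sum.simps(2)) (intro max.mono add_mono order_refl)
qed (simp)

lemma maximal_sum_mono: "N \<le> K \<Longrightarrow> maximal_sum T g N x \<le> maximal_sum T g K x"
  by (rule lift_Suc_mono_le[of "\<lambda>N. maximal_sum T g N x", OF maximal_sum_Suc_mono])

lemma sum_le_maximal_sum: "(\<Sum>k<n. g ((T ^^ k) x)) \<le> maximal_sum T g n x"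
proof (induction n arbitrary: x)
  case (Suc n)
  have "(\<Sum>k<Suc n. g ((T ^^ k) x)) = g x + (\<Sum>k<n. g ((T ^^ k) (T x)))"
    by (subst sum.lessThan_Suc_shift) (simp add: funpow_swap1)
  with Suc[of "T x"] show ?case by simp
qed simp

lemma maximal_sum_bounded:
  assumes "\<And>x. \<bar>g x\<bar> \<le> B"
  shows "\<bar>maximal_sum T g N x\<bar> \<le> real N * B"
proof (induction N arbitrary: x)
  case (Suc N)
  have "B \<ge> 0" using assms[of x] by linarith
  then have "0 \<le> real (Suc N) * B" by (intro mult_nonneg_nonneg) auto
  then show ?case
    using assms[of x] Suc[of "T x"] by (auto simp: max_def algebra_simps)
qed simp

section \<open>Maximal ergodic inequality and pointwise convergence\<close>

locale measure_preserving_system = prob_space M for M :: "'a measure" +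
  fixes T :: "'a \<Rightarrow> 'a"
  assumes T_measurable [measurable]: "T \<in> M \<rightarrow>\<^sub>M M"
    and distr_T: "distr M M T = M"
begin

lemma funpow_measurable [measurable]: "(T ^^ k) \<in> M \<rightarrow>\<^sub>M M"
  by (induction k) (auto simp: id_def comp_def)

lemma measurable_compose_funpow:
  "g \<in> M \<rightarrow>\<^sub>M N \<Longrightarrow> (\<lambda>x. g ((T ^^ k) x)) \<in> M \<rightarrow>\<^sub>M N"
  by (rule measurable_compose[OF funpow_measurable])

lemma birkhoff_average_measurable [measurable]:
  "f \<in> borel_measurable M \<Longrightarrow> birkhoff_average T f n \<in> borel_measurable M"
  unfolding birkhoff_average_def[abs_def]
  by (intro borel_measurable_divide borel_measurable_sum borel_measurable_const measurable_compose_funpow)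

lemma birkhoff_limit_measurable [measurable]:
  "f \<in> borel_measurable M \<Longrightarrow> birkhoff_limit T f \<in> borel_measurable M"
  unfolding birkhoff_limit_def[abs_def]
  by (intro borel_measurable_real_of_ereal borel_measurable_limsup borel_measurable_ereal birkhoff_average_measurable)

lemma maximal_sum_measurable [measurable]:
  assumes [measurable]: "g \<in> borel_measurable M"
  shows "maximal_sum T g N \<in> borel_measurable M"
proof (induction N)
  case 0
  have "maximal_sum T g 0 = (\<lambda>x. 0)" by (rule ext) simp
  then show ?case by (metis borel_measurable_const)
next
  case (Suc N)
  note Suc[measurable]
  have "maximal_sum T g (Suc N) = (\<lambda>x. max 0 (g x + maximal_sum T g N (T x)))"
    by (rule ext) simp
  moreover have "(\<lambda>x. max 0 (g x + maximal_sum T g N (T x))) \<in> borel_measurable M"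
    by measurable
  ultimately show ?case by metis
qed

lemma integral_T:
  assumes "g \<in> borel_measurable M"
  shows "(\<integral>x. g (T x) \<partial>M) = (\<integral>x. g x \<partial>M :: real)"
  using integral_distr[OF T_measurable assms] by (simp add: distr_T)

lemma integral_funpow:
  assumes [measurable]: "g \<in> borel_measurable M"
  shows "(\<integral>x. g ((T ^^ k) x) \<partial>M) = (\<integral>x. g x \<partial>M :: real)"
proof (induction k)
  case (Suc k)
  then show ?case
    using integral_T[OF measurable_compose_funpow[OF assms], of k] by (simp add: funpow_swap1)
qed simp

lemma integrable_bounded:
  "g \<in> borel_measurable M \<Longrightarrow> (\<And>x. \<bar>g x\<bar> \<le> B) \<Longrightarrow> integrable M (g :: 'a \<Rightarrow> real)"
  by (rule integrable_const_bound[of g B]) auto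

lemma integral_birkhoff_average:
  assumes [measurable]: "f \<in> borel_measurable M" and B: "\<And>x. \<bar>f x\<bar> \<le> B" and "n > 0"
  shows "(\<integral>x. birkhoff_average T f n x \<partial>M) = (\<integral>x. f x \<partial>M)"
proof -
  have "(\<integral>x. birkhoff_average T f n x \<partial>M) = (\<Sum>k<n. \<integral>x. f ((T ^^ k) x) \<partial>M) / real n"
    unfolding birkhoff_average_def
    using integrable_bounded[OF measurable_compose_funpow[OF assms(1)] B]
    by (simp add: Bochner_Integration.integral_sum)
  with \<open>n > 0\<close> show ?thesis by (simp add: integral_funpow)
qed

text \<open>Garsia's argument. Where the maximum \<open>?m x\<close> is positive, the recursion and
  monotonicity in \<open>N\<close> give \<open>?m x - ?m (T x) \<le> g x\<close>; elsewhere
  \<open>?m x\<close> is 0 and \<open>?m (T x)\<close> is nonnegative. The integral of the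
  difference vanishes by invariance of the measure.\<close>

lemma maximal_ergodic:
  assumes [measurable]: "g \<in> borel_measurable M" and B: "\<And>x. \<bar>g x\<bar> \<le> B"
  shows "0 \<le> (\<integral>x. g x * indicator {x. maximal_sum T g N x > 0} x \<partial>M)"
proof -
  let ?m = "maximal_sum T g N"
  have int: "integrable M ?m" "integrable M (\<lambda>x. ?m (T x))"
    using maximal_sum_bounded[where g=g, OF B] by (auto intro!: integrable_bounded)
  have "0 = (\<integral>x. ?m x - ?m (T x) \<partial>M)"
    using int by (simp add: integral_T)
  also have "\<dots> \<le> (\<integral>x. g x * indicator {x. ?m x > 0} x \<partial>M)"
  proof (rule integral_mono)
    show "integrable M (\<lambda>x. ?m x - ?m (T x))" using int by simp
    show "integrable M (\<lambda>x. g x * indicator {x. ?m x > 0} x)"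
      by (rule integrable_const_bound[where B=B])
        (use B in \<open>auto simp: indicator_def intro: order_trans[OF abs_ge_zero]\<close>)
    fix x
    show "?m x - ?m (T x) \<le> g x * indicator {x. ?m x > 0} x"
    proof (cases N)
      case (Suc K)
      show ?thesis
        using maximal_sum_Suc_mono[of T g K "T x"] maximal_sum_nonneg[of T g N "T x"]
        by (auto simp: Suc indicator_def split: if_splits)
    qed simp
  qed
  finally show ?thesis .
qed

text \<open>Apply the maximal inequality to \<open>f - F + \<epsilon>\<close>, with \<open>F\<close> the invariant upper limit: some partial
  sum of this function is positive at every point, so the positivity sets exhaust the space.\<close>

lemma integral_birkhoff_limit_le:
  assumes [measurable]: "f \<in> borel_measurable M" and B: "\<And>x. \<bar>f x\<bar> \<le> B"
  shows "(\<integral>x. birkhoff_limit T f x \<partial>M) \<le> (\<integral>x. f x \<partial>M)"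
proof (rule field_le_epsilon)
  fix e :: real assume "e > 0"
  let ?F = "birkhoff_limit T f"
  define g where "g = (\<lambda>x. f x - ?F x + e)"
  note bF = limsup_birkhoff_average(2)[where f=f, OF B]
  have [measurable]: "g \<in> borel_measurable M" by (simp add: g_def)
  have gB: "\<bar>g x\<bar> \<le> 2 * B + e" for x
    using B[of x] bF[of T x] \<open>e > 0\<close> by (auto simp: g_def)
  have pos: "\<exists>n. (\<Sum>k<n. g ((T ^^ k) x)) > 0" for x
  proof -
    have "\<not> (\<forall>\<^sub>F n in sequentially. ereal (birkhoff_average T f n x) \<le> ereal (?F x - e))"
    proof
      assume "\<forall>\<^sub>F n in sequentially. ereal (birkhoff_average T f n x) \<le> ereal (?F x - e)"
      then have "limsup (\<lambda>n. ereal (birkhoff_average T f n x)) \<le> ereal (?F x - e)"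
        by (rule Limsup_bounded)
      with \<open>e > 0\<close> show False by (simp add: limsup_birkhoff_average(1)[where f=f, OF B])
    qed
    \<comment> \<open>A positive \<open>n\<close> is required because the inequality is multiplied
      by \<open>real n\<close> next.\<close>
    then obtain n where n: "?F x - e < birkhoff_average T f n x" "n \<ge> Suc 0"
      unfolding eventually_sequentially by (force simp: not_le)
    then have "real n * (?F x - e) < (\<Sum>k<n. f ((T ^^ k) x))"
      by (simp add: birkhoff_average_def field_simps)
    \<comment> \<open>\<open>?F\<close> is constant along the orbit, so its contribution to the sum
      is just a multiple of \<open>n\<close>.\<close>
    moreover have "(\<Sum>k<n. g ((T ^^ k) x)) = (\<Sum>k<n. f ((T ^^ k) x)) - real n * (?F x - e)"
      by (simp add: g_def sum.distrib sum_subtractf birkhoff_limit_invariant_funpow[where f=f, OF B] algebra_simps)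
    ultimately show ?thesis by (intro exI[of _ n]) simp
  qed
  have "(\<lambda>N. \<integral>x. g x * indicator {x. maximal_sum T g N x > 0} x \<partial>M) \<longlonglongrightarrow> (\<integral>x. g x \<partial>M)"
  proof (rule integral_dominated_convergence[where w="\<lambda>_. 2 * B + e"])
    show "AE x in M. (\<lambda>N. g x * indicator {x. maximal_sum T g N x > 0} x) \<longlonglongrightarrow> g x"
    proof (rule AE_I2)
      fix x
      obtain n where n: "(\<Sum>k<n. g ((T ^^ k) x)) > 0" using pos by blast
      \<comment> \<open>The maxima grow with \<open>N\<close>, so a point that has entered the
        positivity set stays in it.\<close>
      have "g x * indicator {x. maximal_sum T g N x > 0} x = g x" if "N \<ge> n" for N
        using n sum_le_maximal_sum[of g T x n] maximal_sum_mono[OF that, of T g x] by simp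
      then show "(\<lambda>N. g x * indicator {x. maximal_sum T g N x > 0} x) \<longlonglongrightarrow> g x"
        by (intro tendsto_eventually eventually_sequentiallyI)
    qed
    show "AE x in M. norm (g x * indicator {x. maximal_sum T g N x > 0} x) \<le> 2 * B + e" for N
      using gB by (auto simp: indicator_def intro: order_trans[OF abs_ge_zero])
  qed auto
  moreover have "0 \<le> (\<integral>x. g x * indicator {x. maximal_sum T g N x > 0} x \<partial>M)" for N
    by (rule maximal_ergodic[where g=g, OF _ gB]) measurable
  ultimately have "0 \<le> (\<integral>x. g x \<partial>M)"
    by (intro LIMSEQ_le_const) auto
  also have "\<dots> = (\<integral>x. f x \<partial>M) - (\<integral>x. ?F x \<partial>M) + e"
  proof -
    have "integrable M f" "integrable M ?F"
      using B bF by (auto intro!: integrable_bounded)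
    then show ?thesis unfolding g_def by (simp add: prob_space)
  qed
  finally show "(\<integral>x. ?F x \<partial>M) \<le> (\<integral>x. f x \<partial>M) + e" by simp
qed

text \<open>The one-sided bound is applied to \<open>f\<close> and to \<open>- f\<close>. The sum of
  the two upper limits is the gap between upper and lower limit, hence nonnegative, while the two
  bounds make its integral at most 0. So the gap is zero almost everywhere and both bounds are
  equalities.\<close>

theorem birkhoff:
  assumes [measurable]: "f \<in> borel_measurable M" and B: "\<And>x. \<bar>f x\<bar> \<le> B"
  shows "AE x in M. (\<lambda>n. birkhoff_average T f n x) \<longlonglongrightarrow> birkhoff_limit T f x"
    and "(\<integral>x. birkhoff_limit T f x \<partial>M) = (\<integral>x. f x \<partial>M)"
proof -
  let ?g = "\<lambda>x. - f x"
  let ?F = "birkhoff_limit T f" and ?G = "birkhoff_limit T ?g"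
  have Bg: "\<bar>?g x\<bar> \<le> B" for x using B by simp
  have neg: "birkhoff_average T ?g n x = - birkhoff_average T f n x" for n x
    by (simp add: birkhoff_average_def sum_negf)
  have liminf: "ereal (- ?G x) = liminf (\<lambda>n. ereal (birkhoff_average T f n x))" for x
    using limsup_birkhoff_average(1)[where f="?g", OF Bg, of T x]
      ereal_Limsup_uminus[of sequentially "\<lambda>n. ereal (birkhoff_average T f n x)"]
    by (simp add: neg) (metis ereal_uminus_uminus uminus_ereal.simps(1))
  have nonneg: "0 \<le> ?F x + ?G x" for x
  proof -
    have "ereal (- ?G x) \<le> ereal (?F x)"
      unfolding liminf limsup_birkhoff_average(1)[where f=f, OF B, symmetric]
      by (rule Liminf_le_Limsup) simp
    then show ?thesis by simp
  qed
  have int: "integrable M ?F" "integrable M ?G" "integrable M f"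
    using limsup_birkhoff_average(2)[where f=f, OF B] limsup_birkhoff_average(2)[where f="?g", OF Bg] B
    by (auto intro!: integrable_bounded)
  have le: "(\<integral>x. ?F x \<partial>M) \<le> (\<integral>x. f x \<partial>M)" "(\<integral>x. ?G x \<partial>M) \<le> - (\<integral>x. f x \<partial>M)"
    using integral_birkhoff_limit_le[OF _ B] integral_birkhoff_limit_le[OF _ Bg] by auto
  have "0 \<le> (\<integral>x. ?F x + ?G x \<partial>M)" using nonneg by (simp add: integral_nonneg_AE)
  then have zero: "(\<integral>x. ?F x + ?G x \<partial>M) = 0" and "(\<integral>x. ?F x \<partial>M) = (\<integral>x. f x \<partial>M)"
    using le int by auto
  then show "(\<integral>x. ?F x \<partial>M) = (\<integral>x. f x \<partial>M)" by simp
  have "AE x in M. ?F x + ?G x = 0"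
    using zero nonneg int by (subst (asm) integral_nonneg_eq_0_iff_AE) auto
  then show "AE x in M. (\<lambda>n. birkhoff_average T f n x) \<longlonglongrightarrow> ?F x"
  proof eventually_elim
    case (elim x)
    then have "liminf (\<lambda>n. ereal (birkhoff_average T f n x)) = ereal (?F x)"
      using liminf[of x] by (metis add_eq_0_iff2)
    then have "(\<lambda>n. ereal (birkhoff_average T f n x)) \<longlonglongrightarrow> ereal (?F x)"
      using limsup_birkhoff_average(1)[where f=f, OF B] by (intro Liminf_eq_Limsup) auto
    then show ?case by simp
  qed
qed

section \<open>Second moments of averages\<close>

lemma birkhoff_average_L2_tendsto:
  assumes [measurable]: "f \<in> borel_measurable M" and B: "\<And>x. \<bar>f x\<bar> \<le> B"
  shows "(\<lambda>m. \<integral>x. (birkhoff_average T f (Suc m) x)\<^sup>2 \<partial>M) \<longlonglongrightarrow> (\<integral>x. (birkhoff_limit T f x)\<^sup>2 \<partial>M)"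
proof (rule integral_dominated_convergence[where w="\<lambda>_. B\<^sup>2"])
  show "AE x in M. (\<lambda>m. (birkhoff_average T f (Suc m) x)\<^sup>2) \<longlonglongrightarrow> (birkhoff_limit T f x)\<^sup>2"
    using birkhoff(1)[OF assms]
    by eventually_elim (intro tendsto_power LIMSEQ_Suc)
  show "AE x in M. norm ((birkhoff_average T f (Suc m) x)\<^sup>2) \<le> B\<^sup>2" for m
    using birkhoff_average_bounded[where f=f, OF B] by (auto intro!: AE_I2 abs_le_square_iff[THEN iffD1] simp: abs_le_iff order_trans[OF _ abs_ge_self])
qed auto

text \<open>Jensen's inequality along the orbit, linearized: a square is at least
  \<open>2 * c\<close> times its root minus the square of \<open>c\<close>. With \<open>c\<close>
  the Birkhoff limit at \<open>x\<close>, the averages of this lower bound tend to the square of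
  \<open>c\<close>.\<close>

lemma power2_birkhoff_limit_le:
  assumes [measurable]: "f \<in> borel_measurable M" and B: "\<And>x. \<bar>f x\<bar> \<le> B" and "m > 0"
  shows "AE x in M. (birkhoff_limit T f x)\<^sup>2 \<le> birkhoff_limit T (\<lambda>y. (birkhoff_average T f m y)\<^sup>2) x"
proof -
  let ?g = "birkhoff_average T f m"
  have gB: "\<bar>(?g y)\<^sup>2\<bar> \<le> B\<^sup>2" for y
    using power_mono[OF birkhoff_average_bounded[where f=f, OF B, of T m y] abs_ge_zero, of 2] by simp
  have "AE x in M. (\<lambda>n. birkhoff_average T (\<lambda>y. (?g y)\<^sup>2) n x) \<longlonglongrightarrow> birkhoff_limit T (\<lambda>y. (?g y)\<^sup>2) x"
    by (rule birkhoff(1)[OF _ gB]) measurable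
  with birkhoff(1)[OF assms(1) B] show ?thesis
  proof eventually_elim
    case (elim x)
    define c where "c = birkhoff_limit T f x"
    have "(\<lambda>n. 2 * c * birkhoff_average T ?g n x) \<longlonglongrightarrow> 2 * c * c"
      using elim(1) unfolding c_def[symmetric]
      by (intro tendsto_mult tendsto_const birkhoff_average_average_tendsto[where f=f, OF B _ \<open>m > 0\<close>])
    then have "(\<lambda>n. 2 * c * birkhoff_average T ?g n x + - c\<^sup>2) \<longlonglongrightarrow> 2 * c * c + - c\<^sup>2"
      by (intro tendsto_add tendsto_const)
    moreover have "2 * c * birkhoff_average T ?g n x + - c\<^sup>2 \<le> birkhoff_average T (\<lambda>y. (?g y)\<^sup>2) n x"
      if "n > 0" for n
    proof -
      have "2 * c * birkhoff_average T ?g n x + - c\<^sup>2 = birkhoff_average T (\<lambda>y. 2 * c * ?g y + - c\<^sup>2) n x"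
        using that by (simp only: birkhoff_average_add birkhoff_average_cmult birkhoff_average_const)
      also have "\<dots> \<le> birkhoff_average T (\<lambda>y. (?g y)\<^sup>2) n x"
      proof (rule birkhoff_average_mono)
        fix y
        have "0 \<le> (?g y - c)\<^sup>2" by simp
        then show "2 * c * ?g y + - c\<^sup>2 \<le> (?g y)\<^sup>2" by (simp add: power2_diff algebra_simps)
      qed
      finally show ?thesis .
    qed
    ultimately have "2 * c * c + - c\<^sup>2 \<le> birkhoff_limit T (\<lambda>y. (?g y)\<^sup>2) x"
      using elim(2) by (intro LIMSEQ_le[of "\<lambda>n. 2 * c * birkhoff_average T ?g n x + - c\<^sup>2"]) (auto intro!: exI[of _ 1])
    then show ?case by (simp add: c_def power2_eq_square)
  qed
qed

text \<open>The \<open>L\<^sup>1\<close> limit of the nonnegative differences is zero by dominated convergence, hence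
  their infimum vanishes almost everywhere.\<close>

lemma AE_birkhoff_limit_square_less:
  assumes [measurable]: "f \<in> borel_measurable M" and B: "\<And>x. \<bar>f x\<bar> \<le> B" and "e > 0"
  shows "AE x in M. \<exists>m. birkhoff_limit T (\<lambda>y. (birkhoff_average T f (Suc m) y)\<^sup>2) x < (birkhoff_limit T f x)\<^sup>2 + e"
proof -
  define g where "g = (\<lambda>m y. (birkhoff_average T f (Suc m) y)\<^sup>2)"
  let ?F = "birkhoff_limit T f" and ?G = "\<lambda>m. birkhoff_limit T (g m)"
  have [measurable]: "g m \<in> borel_measurable M" for m unfolding g_def by measurable
  have gB: "\<bar>g m y\<bar> \<le> B\<^sup>2" for m y
    using power_mono[OF birkhoff_average_bounded[where f=f, OF B, of T "Suc m" y] abs_ge_zero, of 2]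
    by (simp add: g_def)
  have FB: "\<bar>(?F y)\<^sup>2\<bar> \<le> B\<^sup>2" for y
    using power_mono[OF limsup_birkhoff_average(2)[where f=f, OF B, of T y] abs_ge_zero, of 2] by simp
  have int: "integrable M (?G m)" "integrable M (\<lambda>x. (?F x)\<^sup>2)" for m
    using limsup_birkhoff_average(2)[where f="g m", OF gB] FB by (auto intro!: integrable_bounded)
  define S where "S = {x \<in> space M. \<forall>m. (?F x)\<^sup>2 + e \<le> ?G m x}"
  have [measurable]: "S \<in> sets M" unfolding S_def by measurable
  \<comment> \<open>\<open>S\<close> lies in the level set belonging to each single
    \<open>m\<close>, so Markov's inequality bounds its measure for all \<open>m\<close> at
    once.\<close>
  have bound: "measure M S \<le> ((\<integral>x. g m x \<partial>M) - (\<integral>x. (?F x)\<^sup>2 \<partial>M)) / e" for m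
  proof -
    have "measure M S \<le> measure M {x \<in> space M. e \<le> ?G m x - (?F x)\<^sup>2}"
      unfolding S_def by (intro finite_measure_mono) (auto simp: le_diff_eq add.commute)
    also have "\<dots> \<le> (\<integral>x. ?G m x - (?F x)\<^sup>2 \<partial>M) / e"
    proof (rule integral_Markov_inequality_measure[where A="space M"])
      show "AE x in M. 0 \<le> ?G m x - (?F x)\<^sup>2"
        using power2_birkhoff_limit_le[OF assms(1) B, of "Suc m"] by (simp add: g_def)
    qed (use int \<open>e > 0\<close> in auto)
    also have "(\<integral>x. ?G m x - (?F x)\<^sup>2 \<partial>M) = (\<integral>x. g m x \<partial>M) - (\<integral>x. (?F x)\<^sup>2 \<partial>M)"
      using int birkhoff(2)[where f="g m", OF _ gB] by simp
    finally show ?thesis .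
  qed
  have "(\<lambda>m. ((\<integral>x. g m x \<partial>M) - (\<integral>x. (?F x)\<^sup>2 \<partial>M)) / e) \<longlonglongrightarrow> ((\<integral>x. (?F x)\<^sup>2 \<partial>M) - (\<integral>x. (?F x)\<^sup>2 \<partial>M)) / e"
    unfolding g_def using \<open>e > 0\<close>
    by (intro tendsto_divide tendsto_diff tendsto_const birkhoff_average_L2_tendsto[OF assms(1) B]) auto
  then have "measure M S \<le> ((\<integral>x. (?F x)\<^sup>2 \<partial>M) - (\<integral>x. (?F x)\<^sup>2 \<partial>M)) / e"
    by (rule LIMSEQ_le_const) (use bound in blast)
  then have "measure M S = 0" by (simp add: measure_le_0_iff)
  then have "AE x in M. x \<notin> S" by (intro AE_not_in) (simp add: null_sets_def emeasure_eq_measure)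
  then show ?thesis
    by (rule AE_mp) (auto intro!: AE_I2 simp: S_def g_def not_le)
qed

end

section \<open>The Riesz representation theorem on compact metric spaces\<close>

text \<open>Closed sets are the convenient generator: they are stable under intersection, and
  nonempty ones are the zero sets of distance functions.\<close>

lemma sets_borel_eq_sigma_closed: "sets borel = sigma_sets UNIV (Collect (closed :: 'a::topological_space set \<Rightarrow> bool))"
proof -
  have "sigma_sets UNIV (Collect (open :: 'a set \<Rightarrow> bool)) = sigma_sets UNIV (Collect closed)"
  proof (rule sigma_sets_eqI)
    fix A :: "'a set" assume "A \<in> Collect open"
    then have "UNIV - (- A) \<in> sigma_sets UNIV (Collect (closed :: 'a set \<Rightarrow> bool))"
      by (intro sigma_sets.Compl sigma_sets.Basic) (simp add: closed_Compl)
    then show "A \<in> sigma_sets UNIV (Collect closed)" by (simp add: Compl_eq_Diff_UNIV[symmetric])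
  next
    fix A :: "'a set" assume "A \<in> Collect closed"
    then have "UNIV - (- A) \<in> sigma_sets UNIV (Collect (open :: 'a set \<Rightarrow> bool))"
      by (intro sigma_sets.Compl sigma_sets.Basic) (simp add: open_Compl)
    then show "A \<in> sigma_sets UNIV (Collect open)" by (simp add: Compl_eq_Diff_UNIV[symmetric])
  qed
  then show ?thesis by (simp add: borel_def)
qed

text \<open>Continuous cutoffs of the distance to a closed set tend to its indicator, so the
  measures agree on closed sets, an intersection-stable generator.\<close>

lemma measure_eqI_continuous:
  fixes M N :: "'a::metric_space measure"
  assumes "finite_measure M" "finite_measure N"
    and sets [simp, measurable_cong]: "sets M = sets borel" "sets N = sets borel"
    and eq: "\<And>f :: 'a \<Rightarrow> real. continuous_on UNIV f \<Longrightarrow> (\<And>x. 0 \<le> f x) \<Longrightarrow> (\<And>x. f x \<le> 1) \<Longrightarrow>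
      (\<integral>x. f x \<partial>M) = (\<integral>x. f x \<partial>N)"
  shows "M = N"
proof -
  interpret M: finite_measure M by fact
  interpret N: finite_measure N by fact
  have space [simp]: "space M = UNIV" "space N = UNIV"
    using sets_eq_imp_space_eq[OF sets(1)] sets_eq_imp_space_eq[OF sets(2)] by simp_all
  have "emeasure M K = emeasure N K" if "closed K" for K
  \<comment> \<open>\<open>infdist\<close> to the empty set is 0 by convention, so the cutoffs would
    not tend to its indicator.\<close>
  proof (cases "K = {}")
    case False
    define f where "f = (\<lambda>n x. max 0 (1 - real n * infdist x K))"
    have cont: "continuous_on UNIV (f n)" for n
      unfolding f_def by (intro continuous_intros)
    have bnd: "0 \<le> f n x" "f n x \<le> 1" for n x
      using infdist_nonneg[of x K] by (auto simp: f_def)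
    have lim: "(\<lambda>n. f n x) \<longlonglongrightarrow> indicator K x" for x
    proof (cases "x \<in> K")
      case True
      then show ?thesis by (simp add: f_def)
    next
      case nK: False
      then have "infdist x K > 0"
        using False \<open>closed K\<close> by (metis in_closed_iff_infdist_zero infdist_nonneg less_eq_real_def)
      then obtain n0 :: nat where n0: "real n0 * infdist x K > 1"
        using reals_Archimedean3 by blast
      have "f n x = indicator K x" if "n \<ge> n0" for n
      proof -
        have "real n0 * infdist x K \<le> real n * infdist x K"
          using that by (intro mult_right_mono infdist_nonneg) simp
        with n0 nK show ?thesis by (simp add: f_def)
      qed
      then show ?thesis by (intro tendsto_eventually eventually_sequentiallyI)
    qed
    have "(\<lambda>n. \<integral>x. f n x \<partial>Q) \<longlonglongrightarrow> measure Q K" if "finite_measure Q" "sets Q = sets borel" for Q :: "'a measure"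
    proof -
      interpret Q: finite_measure Q by fact
      note [measurable_cong] = \<open>sets Q = sets borel\<close>
      have [measurable]: "f n \<in> borel_measurable Q" for n
        using borel_measurable_continuous_onI[OF cont] by (subst measurable_cong_sets[OF that(2) refl])
      have [measurable]: "K \<in> sets Q" using \<open>closed K\<close> that by simp
      have "(\<lambda>n. \<integral>x. f n x \<partial>Q) \<longlonglongrightarrow> (\<integral>x. indicator K x \<partial>Q)"
        by (rule integral_dominated_convergence[where w="\<lambda>_. 1"]) (use lim bnd in auto)
      then show ?thesis by (simp add: sets.Int_space_eq2)
    qed
    from this[of M] this[of N] have "measure M K = measure N K"
      using eq[OF cont bnd] assms by (auto intro: LIMSEQ_unique)
    then show ?thesis by (simp add: M.emeasure_eq_measure N.emeasure_eq_measure)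
  qed simp
  then show ?thesis
    by (intro measure_eqI_generator_eq[where E="Collect closed" and \<Omega>=UNIV and A="\<lambda>_. UNIV"])
      (auto simp: sets_borel_eq_sigma_closed Int_stable_def)
qed

section \<open>Outer measure of a positive functional\<close>

locale normalized_positive_functional =
  fixes L :: "('a::metric_space \<Rightarrow> real) \<Rightarrow> real"
  assumes compact: "compact (UNIV :: 'a set)"
    and add: "\<And>f g. continuous_on UNIV f \<Longrightarrow> continuous_on UNIV g \<Longrightarrow> L (\<lambda>x. f x + g x) = L f + L g"
    and cmult: "\<And>f c. continuous_on UNIV f \<Longrightarrow> L (\<lambda>x. c * f x) = c * L f"
    and nonneg: "\<And>f. continuous_on UNIV f \<Longrightarrow> (\<And>x. 0 \<le> f x) \<Longrightarrow> 0 \<le> L f"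
    and one: "L (\<lambda>x. 1) = 1"
begin

lemma const: "L (\<lambda>x. c) = c"
  using cmult[of "\<lambda>x. 1" c] one by simp

lemma mono:
  assumes "continuous_on UNIV f" "continuous_on UNIV g" "\<And>x. f x \<le> g x"
  shows "L f \<le> L g"
proof -
  have "L g = L (\<lambda>x. f x + (g x - f x))" by simp
  also have "\<dots> = L f + L (\<lambda>x. g x - f x)" using assms by (intro add continuous_intros)
  finally show ?thesis using nonneg[of "\<lambda>x. g x - f x"] assms by (simp add: continuous_on_diff)
qed

lemma sum:
  assumes "\<And>i. i \<in> I \<Longrightarrow> continuous_on UNIV (f i)"
  shows "L (\<lambda>x. \<Sum>i\<in>I. f i x) = (\<Sum>i\<in>I. L (f i))"
  using assms
proof (induction I rule: infinite_finite_induct)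
  case (insert i I)
  then show ?case by (simp add: add continuous_on_sum)
qed (simp_all add: const)

text \<open>An increasing sequence stands for its supremum, a lower semicontinuous majorant of the
  indicator of \<open>E\<close>; \<open>outer\<close> is then the Daniell upper integral of that
  indicator. Single continuous majorants would only see the closure of \<open>E\<close>, which
  spoils countable subadditivity.\<close>

definition covers :: "'a set \<Rightarrow> (nat \<Rightarrow> 'a \<Rightarrow> real) \<Rightarrow> bool" where
  "covers E h \<longleftrightarrow> (\<forall>n. continuous_on UNIV (h n)) \<and> (\<forall>n x. 0 \<le> h n x) \<and>
    (\<forall>m n x. m \<le> n \<longrightarrow> h m x \<le> h n x) \<and> (\<forall>x\<in>E. 1 \<le> (SUP n. ennreal (h n x)))"

definition outer :: "'a set \<Rightarrow> ennreal" where
  "outer E = (INF h\<in>Collect (covers E). SUP n. ennreal (L (h n)))"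

lemma covers_const: "continuous_on UNIV f \<Longrightarrow> (\<And>x. 0 \<le> f x) \<Longrightarrow> (\<And>x. x \<in> E \<Longrightarrow> 1 \<le> f x) \<Longrightarrow> covers E (\<lambda>n. f)"
  by (auto simp: covers_def)

lemma outer_le: "covers E h \<Longrightarrow> outer E \<le> (SUP n. ennreal (L (h n)))"
  unfolding outer_def by (rule INF_lower) simp

lemma outer_le_continuous:
  assumes "continuous_on UNIV f" "\<And>x. 0 \<le> f x" "\<And>x. x \<in> E \<Longrightarrow> 1 \<le> f x"
  shows "outer E \<le> ennreal (L f)"
  using outer_le[OF covers_const[OF assms]] by simp

lemma outer_empty: "outer {} = 0"
  using outer_le_continuous[of "\<lambda>x. 0" "{}"] by (simp add: const)

lemma outer_le_1: "outer E \<le> 1"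
  using outer_le_continuous[of "\<lambda>x. 1" E] by (simp add: const)

lemma outer_mono: "E \<subseteq> F \<Longrightarrow> outer E \<le> outer F"
  unfolding outer_def by (rule INF_superset_mono) (unfold covers_def, blast, simp)

lemma outer_approx:
  assumes "e > 0"
  obtains h where "covers E h" "(SUP n. ennreal (L (h n))) < outer E + ennreal e"
proof -
  have "outer E < \<infinity>" using outer_le_1[of E] by (simp add: order_le_less_trans)
  then have "outer E < outer E + ennreal e"
    using assms by (metis add.right_neutral ennreal_add_left_cancel_less ennreal_less_zero_iff infinity_ennreal_def less_irrefl)
  then show ?thesis
    unfolding outer_def INF_less_iff using that by (auto simp: outer_def)
qed

lemma outer_UN_le: "outer (\<Union>i. E i) \<le> (\<Sum>i. outer (E i))"
proof (rule ennreal_le_epsilon)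
  fix e :: real assume "e > 0"
  then have "\<exists>h. covers (E i) h \<and> (SUP n. ennreal (L (h n))) < outer (E i) + ennreal (e * (1/2) ^ Suc i)" for i
    using outer_approx[of "e * (1/2) ^ Suc i" "E i"] by (metis half_gt_zero_iff mult_pos_pos zero_less_one zero_less_power)
  then obtain h where h: "\<And>i. covers (E i) (h i)"
    "\<And>i. (SUP n. ennreal (L (h i n))) < outer (E i) + ennreal (e * (1/2) ^ Suc i)"
    by metis
  have cont: "continuous_on UNIV (h i n)" and nn: "0 \<le> h i n x" and inc: "m \<le> n \<Longrightarrow> h i m x \<le> h i n x"
    and cov: "x \<in> E i \<Longrightarrow> 1 \<le> (SUP n. ennreal (h i n x))" for i m n x
    using h(1)[of i] by (auto simp: covers_def)
  \<comment> \<open>A diagonal cover: every member is a finite sum, to which additivity of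
    \<open>L\<close> applies, and it grows both in the summands and in their number.\<close>
  define H where "H = (\<lambda>n x. \<Sum>i<n. h i n x)"
  have "covers (\<Union>i. E i) H"
    unfolding covers_def
  proof (intro conjI allI impI ballI)
    show "continuous_on UNIV (H n)" for n unfolding H_def by (intro continuous_on_sum cont)
    show "0 \<le> H n x" for n x unfolding H_def by (intro sum_nonneg nn)
    fix m n :: nat and x assume "m \<le> n"
    then have "H m x \<le> (\<Sum>i<m. h i n x)" unfolding H_def by (intro sum_mono inc)
    also have "\<dots> \<le> H n x" unfolding H_def using \<open>m \<le> n\<close> by (intro sum_mono2 nn) auto
    finally show "H m x \<le> H n x" .
  next
    fix x assume "x \<in> (\<Union>i. E i)"
    then obtain i where "x \<in> E i" by blast
    then have "1 \<le> (SUP n. ennreal (h i n x))" by (rule cov)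
    also have "\<dots> \<le> (SUP n. ennreal (H n x))"
    proof (rule SUP_mono)
      fix n
      \<comment> \<open>The cover of \<open>E i\<close> contributes to \<open>H ?N\<close> only if
        \<open>?N\<close> exceeds \<open>i\<close>.\<close>
      let ?N = "max n (Suc i)"
      have "h i n x \<le> h i ?N x" by (intro inc) simp
      also have "\<dots> \<le> H ?N x" unfolding H_def by (intro member_le_sum nn) auto
      finally show "\<exists>m\<in>UNIV. ennreal (h i n x) \<le> ennreal (H m x)"
        by (auto intro: ennreal_leI)
    qed
    finally show "1 \<le> (SUP n. ennreal (H n x))" .
  qed
  then have "outer (\<Union>i. E i) \<le> (SUP n. ennreal (L (H n)))" by (rule outer_le)
  also have "\<dots> \<le> (\<Sum>i. outer (E i) + ennreal (e * (1/2) ^ Suc i))"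
  proof (rule SUP_least)
    fix n
    have "ennreal (L (H n)) = (\<Sum>i<n. ennreal (L (h i n)))"
      unfolding H_def by (simp add: sum cont nonneg nn sum_ennreal)
    also have "\<dots> \<le> (\<Sum>i<n. outer (E i) + ennreal (e * (1/2) ^ Suc i))"
      by (intro sum_mono order_trans[OF SUP_upper less_imp_le[OF h(2)]]) simp
    also have "\<dots> \<le> (\<Sum>i. outer (E i) + ennreal (e * (1/2) ^ Suc i))"
      by (intro sum_le_suminf) auto
    finally show "ennreal (L (H n)) \<le> (\<Sum>i. outer (E i) + ennreal (e * (1/2) ^ Suc i))" .
  qed
  also have "\<dots> = (\<Sum>i. outer (E i)) + (\<Sum>i. ennreal (e * (1/2) ^ Suc i))"
    by (intro suminf_add[symmetric] summableI)
  also have "(\<Sum>i. ennreal (e * (1/2) ^ Suc i)) = ennreal e"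
    using \<open>e > 0\<close> sums_mult[OF power_half_series, of e] by (intro suminf_ennreal_eq) auto
  finally show "outer (\<Union>i. E i) \<le> (\<Sum>i. outer (E i)) + ennreal e" .
qed

lemma outer_measure_space_outer: "outer_measure_space UNIV outer"
  unfolding outer_measure_space_def positive_def increasing_def countably_subadditive_def
  using outer_empty outer_mono outer_UN_le by auto

text \<open>Cutting a cover of \<open>E\<close> with \<open>min 1 (n \<cdot> dist(x, K))\<close>, where \<open>n\<close> moves along with the cover, covers
  \<open>E - K\<close>; cutting it with the complementary factor for a fixed \<open>n\<close> covers \<open>E \<inter> K\<close>.\<close>

lemma outer_closed_split:
  assumes "closed K" "K \<noteq> {}"
  shows "outer (E - K) + outer (E \<inter> K) \<le> outer E"
  unfolding outer_def[of E]
proof (rule INF_greatest)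
  fix h assume "h \<in> Collect (covers E)"
  then have cont: "continuous_on UNIV (h n)" and nn: "0 \<le> h n x" and inc: "m \<le> n \<Longrightarrow> h m x \<le> h n x"
    and cov: "x \<in> E \<Longrightarrow> 1 \<le> (SUP n. ennreal (h n x))" for m n x
    by (auto simp: covers_def)
  define f where "f = (\<lambda>n x. min 1 (real n * infdist x K))"
  have fc: "continuous_on UNIV (f n)" for n
    unfolding f_def by (intro continuous_intros)
  have f01: "0 \<le> f n x" "f n x \<le> 1" for n x
    by (auto simp: f_def infdist_nonneg)
  have f_inc: "f m x \<le> f n x" if "m \<le> n" for m n x
    using that unfolding f_def by (intro min.mono mult_right_mono infdist_nonneg) auto
  have f_K: "f n x = 0" if "x \<in> K" for n x
    using that by (simp add: f_def)
  have f_1: "\<exists>N. \<forall>n\<ge>N. f n x = 1" if "x \<notin> K" for x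
  proof -
    have "infdist x K > 0"
      using that assms by (metis in_closed_iff_infdist_zero infdist_nonneg less_eq_real_def)
    then obtain N :: nat where N: "real N * infdist x K > 1"
      using reals_Archimedean3 by blast
    have "f N x = 1" using N by (simp add: f_def)
    then have "f n x = 1" if "n \<ge> N" for n using f_inc[OF that, of x] f01(2)[of n x] by simp
    then show ?thesis by blast
  qed
  have "covers (E - K) (\<lambda>n x. h n x * f n x)"
    unfolding covers_def
  proof (intro conjI allI impI ballI)
    show "continuous_on UNIV (\<lambda>x. h n x * f n x)" for n by (intro continuous_on_mult cont fc)
    show "0 \<le> h n x * f n x" for n x by (intro mult_nonneg_nonneg nn f01)
    show "h m x * f m x \<le> h n x * f n x" if "m \<le> n" for m n x
      using that by (intro mult_mono inc f_inc nn f01)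
    fix x assume x: "x \<in> E - K"
    then obtain N where N: "\<And>n. n \<ge> N \<Longrightarrow> f n x = 1" using f_1 by blast
    have "1 \<le> (SUP n. ennreal (h n x))" using x by (intro cov) simp
    also have "\<dots> \<le> (SUP n. ennreal (h n x * f n x))"
    proof (rule SUP_mono)
      fix n
      have "h n x \<le> h (max n N) x * f (max n N) x" using inc[of n "max n N" x] by (simp add: N)
      then show "\<exists>m\<in>UNIV. ennreal (h n x) \<le> ennreal (h m x * f m x)"
        by (auto intro: ennreal_leI)
    qed
    finally show "1 \<le> (SUP n. ennreal (h n x * f n x))" .
  qed
  then have "outer (E - K) \<le> (SUP n. ennreal (L (\<lambda>x. h n x * f n x)))" by (rule outer_le)
  then have "outer (E - K) + outer (E \<inter> K) \<le> (SUP n. ennreal (L (\<lambda>x. h n x * f n x))) + outer (E \<inter> K)"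
    by (rule add_right_mono)
  also have "\<dots> = (SUP n. ennreal (L (\<lambda>x. h n x * f n x)) + outer (E \<inter> K))"
    by (rule ennreal_SUP_add_left[symmetric]) simp
  also have "\<dots> \<le> (SUP n. ennreal (L (h n)))"
  proof (rule SUP_least)
    fix k
    have c1: "continuous_on UNIV (\<lambda>x. h n x * f k x)" "continuous_on UNIV (\<lambda>x. h n x * (1 - f k x))" for n
      by (intro continuous_on_mult continuous_on_diff continuous_on_const cont fc)+
    have p1: "0 \<le> h n x * f k x" "0 \<le> h n x * (1 - f k x)" for n x
      using nn f01 by auto
    have "covers (E \<inter> K) (\<lambda>n x. h n x * (1 - f k x))"
      unfolding covers_def
      using c1 p1 cov inc f01(2) by (auto simp: f_K intro!: mult_right_mono)
    then have "outer (E \<inter> K) \<le> (SUP n. ennreal (L (\<lambda>x. h n x * (1 - f k x))))" by (rule outer_le)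
    then have "ennreal (L (\<lambda>x. h k x * f k x)) + outer (E \<inter> K) \<le>
      ennreal (L (\<lambda>x. h k x * f k x)) + (SUP n. ennreal (L (\<lambda>x. h n x * (1 - f k x))))"
      by (rule add_left_mono)
    also have "\<dots> = (SUP n. ennreal (L (\<lambda>x. h k x * f k x)) + ennreal (L (\<lambda>x. h n x * (1 - f k x))))"
      by (rule ennreal_SUP_add_right) simp
    also have "\<dots> \<le> (SUP n. ennreal (L (h n)))"
    proof (rule SUP_mono)
      fix n
      \<comment> \<open>Raised to a common index, the two pieces come from one function
        \<open>h ?m\<close>, cut by factors that add up to 1.\<close>
      let ?m = "max k n"
      have "L (\<lambda>x. h k x * f k x) + L (\<lambda>x. h n x * (1 - f k x)) \<le>
        L (\<lambda>x. h ?m x * f k x) + L (\<lambda>x. h ?m x * (1 - f k x))"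
        using f01 by (intro add_mono mono c1 mult_right_mono inc) auto
      also have "\<dots> = L (\<lambda>x. h ?m x * f k x + h ?m x * (1 - f k x))"
        by (rule add[symmetric]) (rule c1)+
      also have "\<dots> = L (h ?m)" by (simp add: algebra_simps)
      finally show "\<exists>m\<in>UNIV. ennreal (L (\<lambda>x. h k x * f k x)) + ennreal (L (\<lambda>x. h n x * (1 - f k x))) \<le> ennreal (L (h m))"
        using nonneg[OF c1(1) p1(1)] nonneg[OF c1(2) p1(2)]
        by (intro bexI[of _ ?m]) (auto simp: ennreal_plus[symmetric] simp del: ennreal_plus intro!: ennreal_leI)
    qed
    finally show "ennreal (L (\<lambda>x. h k x * f k x)) + outer (E \<inter> K) \<le> (SUP n. ennreal (L (h n)))" .
  qed
  finally show "outer (E - K) + outer (E \<inter> K) \<le> (SUP n. ennreal (L (h n)))" .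
qed

text \<open>Compactness enters as in Dini's theorem: an increasing sequence of continuous functions
  with supremum at least 1 everywhere exceeds \<open>1 - e\<close> uniformly from some index on, and
  \<open>L\<close> is monotone.\<close>

lemma outer_UNIV: "outer UNIV = 1"
proof (rule antisym[OF outer_le_1])
  show "1 \<le> outer UNIV"
    unfolding outer_def
  proof (rule INF_greatest)
    fix h assume "h \<in> Collect (covers UNIV)"
    then have cont: "continuous_on UNIV (h n)" and nn: "0 \<le> h n x" and inc: "m \<le> n \<Longrightarrow> h m x \<le> h n x"
      and cov: "1 \<le> (SUP n. ennreal (h n x))" for m n x
      by (auto simp: covers_def)
    show "1 \<le> (SUP n. ennreal (L (h n)))"
    proof (rule ennreal_le_epsilon)
      fix e :: real assume "e > 0"
      define U where "U = (\<lambda>n. {x. 1 - e < h n x})"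
      have Uo: "open (U n)" for n
        unfolding U_def by (intro open_Collect_less continuous_on_const cont)
      have Uc: "UNIV \<subseteq> (\<Union>n. U n)"
      proof
        fix x
        have "ennreal (1 - e) < 1" using \<open>e > 0\<close> by (simp add: ennreal_less_one_iff)
        then have "ennreal (1 - e) < (SUP n. ennreal (h n x))" using cov[of x] by (rule order_less_le_trans)
        then obtain n where "ennreal (1 - e) < ennreal (h n x)" by (auto simp: less_SUP_iff)
        then show "x \<in> (\<Union>n. U n)" using nn by (auto simp: U_def ennreal_less_iff ennreal_lessI intro: exI[of _ n]) (metis ennreal_leI linorder_not_less)
      qed
      obtain I where "I \<subseteq> UNIV" and I: "finite I" "UNIV \<subseteq> (\<Union>n\<in>I. U n)"
        by (rule compactE_image[OF compact Uo Uc])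
      obtain N where N: "\<And>n. n \<in> I \<Longrightarrow> n \<le> N" using I(1) unfolding finite_nat_set_iff_bounded_le by auto
      have ge: "1 - e \<le> h N x" for x
      proof -
        obtain n where "n \<in> I" "x \<in> U n" using I(2) by blast
        then show ?thesis using inc[OF N, of n x] by (simp add: U_def)
      qed
      have "1 - e = L (\<lambda>x. 1 - e)" by (simp add: const)
      also have "\<dots> \<le> L (h N)" using ge by (intro mono cont continuous_on_const)
      finally have "1 \<le> ennreal (L (h N) + e)"
        by (simp add: ennreal_ge_1)
      also have "\<dots> = ennreal (L (h N)) + ennreal e"
        using \<open>e > 0\<close> by (intro ennreal_plus nonneg cont nn) auto
      also have "\<dots> \<le> (SUP n. ennreal (L (h n))) + ennreal e"
        by (intro add_right_mono SUP_upper) simp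
      finally show "1 \<le> (SUP n. ennreal (L (h n))) + ennreal e" .
    qed
  qed
qed

section \<open>The representing measure and its integrals\<close>

definition representing_measure :: "'a measure" where
  "representing_measure = measure_of UNIV (sets borel) outer"

lemma sets_representing_measure [simp, measurable_cong]: "sets representing_measure = sets borel"
  unfolding representing_measure_def by (metis sets.sets_measure_of_eq space_borel)

text \<open>Caratheodory's criterion: the splitting inequality makes closed sets measurable for
  \<open>outer\<close>, hence all Borel sets. This also guarantees that \<open>measure_of\<close>
  does not fall back to the null measure.\<close>

lemma emeasure_representing_measure:
  assumes "A \<in> sets borel"
  shows "emeasure representing_measure A = outer A"
proof -
  interpret P: sigma_algebra UNIV "UNIV :: 'a set set" using sigma_algebra_Pow[of "UNIV :: 'a set"] by simp
  let ?S = "lambda_system UNIV UNIV outer"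
  have ms: "measure_space UNIV ?S outer" by (rule P.caratheodory_lemma[OF outer_measure_space_outer])
  then interpret S: sigma_algebra UNIV ?S by (simp add: measure_space_def)
  have "K \<in> ?S" if "closed K" for K
  proof (cases "K = {}")
    case False
    have "outer (E \<inter> K) + outer (E - K) = outer E" for E
    proof (rule antisym)
      show "outer (E \<inter> K) + outer (E - K) \<le> outer E"
        using outer_closed_split[OF that False, of E] by (simp add: add.commute)
      \<comment> \<open>Padding with empty sets extracts subadditivity for two sets from the
        countable version.\<close>
      let ?A = "\<lambda>i::nat. if i = 0 then E \<inter> K else if i = 1 then E - K else {}"
      have "E \<subseteq> ?A 0 \<union> ?A 1" by auto
      also have "\<dots> \<subseteq> (\<Union>i. ?A i)" by blast
      finally have "outer E \<le> outer (\<Union>i. ?A i)" by (rule outer_mono)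
      also have "\<dots> \<le> (\<Sum>i. outer (?A i))"
        by (rule outer_UN_le)
      also have "\<dots> = (\<Sum>i<2. outer (?A i))"
        by (rule suminf_finite) (auto simp: outer_empty)
      also have "\<dots> = outer (E \<inter> K) + outer (E - K)"
        by (simp add: numeral_2_eq_2)
      finally show "outer E \<le> outer (E \<inter> K) + outer (E - K)" .
    qed
    then show ?thesis by (simp add: P.lambda_system_eq)
  qed simp
  then have "sets borel \<subseteq> ?S"
    unfolding sets_borel_eq_sigma_closed by (intro S.sigma_sets_subset) auto
  then have "measure_space UNIV (sets borel) outer"
    using ms by (intro measure_down[OF ms]) (metis sets.sigma_algebra_axioms space_borel)+
  then show ?thesis
    using assms by (intro emeasure_measure_of[OF representing_measure_def]) (auto simp: measure_space_def)
qed

lemma prob_space_representing_measure: "prob_space representing_measure"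
proof
  have "space representing_measure = UNIV"
    using sets_eq_imp_space_eq[OF sets_representing_measure] by simp
  then show "emeasure representing_measure (space representing_measure) = 1"
    by (simp add: emeasure_representing_measure outer_UNIV)
qed

text \<open>Slicing \<open>f\<close> at the levels \<open>j / N\<close>: the measure of a superlevel set is bounded by the value of \<open>L\<close> at
  the next lower slice.\<close>

lemma integral_representing_measure_le:
  assumes cont: "continuous_on UNIV f" and f01: "\<And>x. 0 \<le> f x" "\<And>x. f x \<le> 1"
  shows "(\<integral>x. f x \<partial>representing_measure) \<le> L f"
proof (rule field_le_epsilon)
  fix e :: real assume "e > 0"
  interpret R: prob_space representing_measure by (rule prob_space_representing_measure)
  obtain K :: nat where K: "1 / real (Suc K) < e" using \<open>e > 0\<close> nat_approx_posE by metis
  define N where "N = real (Suc K)"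
  have "N > 0" by (simp add: N_def)
  \<comment> \<open>The part of \<open>f\<close> between the heights \<open>j / N\<close> and
    \<open>(j + 1) / N\<close>.\<close>
  define s where "s = (\<lambda>j x. min (1 / N) (max 0 (f x - real j / N)))"
  have sc: "continuous_on UNIV (s j)" for j
    unfolding s_def using \<open>N > 0\<close> by (intro continuous_intros cont) auto
  have s0: "0 \<le> s j x" "s j x \<le> 1 / N" for j x using \<open>N > 0\<close> by (auto simp: s_def)
  have [measurable]: "f \<in> borel_measurable borel" "s j \<in> borel_measurable borel" for j
    using cont sc by (auto intro: borel_measurable_continuous_onI)
  have int: "integrable representing_measure (s j)" for j
    by (rule R.integrable_const_bound[where B="1 / N"]) (use s0 in auto)
  have sum_slices: "(\<Sum>j<n. s j x) = min (f x) (real n / N)" for n x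
  proof (induction n)
    case (Suc n)
    have "min t a + min d (max 0 (t - a)) = min t (a + d)" if "d > 0" for t a d :: real
      using that by (auto simp: min_def max_def)
    from this[of "1 / N" "f x" "real n / N"] Suc \<open>N > 0\<close> show ?case
      by (simp add: s_def add_divide_distrib add.commute)
  qed (use f01 in simp)
  have sum_s: "f x = (\<Sum>j<Suc K. s j x)" for x
    using f01(2)[of x] by (subst sum_slices) (simp add: N_def)
  \<comment> \<open>Slice \<open>Suc j\<close> vanishes off \<open>A\<close>, and on
    \<open>A\<close> slice \<open>j\<close> has already reached its full height
    \<open>1 / N\<close>. So \<open>N * s j\<close> is a continuous majorant of the indicator of
    \<open>A\<close>.\<close>
  have slice: "(\<integral>x. s (Suc j) x \<partial>representing_measure) \<le> L (s j)" for j
  proof -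
    define A where "A = {x. real (Suc j) / N \<le> f x}"
    have [measurable]: "A \<in> sets borel" unfolding A_def by measurable
    have "outer A \<le> ennreal (L (\<lambda>x. N * s j x))"
    proof (rule outer_le_continuous)
      show "continuous_on UNIV (\<lambda>x. N * s j x)" by (intro continuous_on_mult continuous_on_const sc)
      show "0 \<le> N * s j x" for x using s0 \<open>N > 0\<close> by simp
      fix x assume "x \<in> A"
      then have "s j x = 1 / N" by (simp add: A_def s_def add_divide_distrib)
      then show "1 \<le> N * s j x" using \<open>N > 0\<close> by simp
    qed
    then have "ennreal (measure representing_measure A) \<le> ennreal (N * L (s j))"
      by (simp add: emeasure_representing_measure R.emeasure_eq_measure[symmetric] cmult sc)
    then have A: "measure representing_measure A \<le> N * L (s j)"
      using nonneg[OF sc s0(1)] \<open>N > 0\<close> by (subst (asm) ennreal_le_iff) auto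
    have "(\<integral>x. s (Suc j) x \<partial>representing_measure) \<le> (\<integral>x. (1 / N) * indicator A x \<partial>representing_measure)"
    proof (rule integral_mono)
      show "integrable representing_measure (\<lambda>x. (1 / N) * indicator A x :: real)"
        by (intro integrable_mult_right) (simp add: R.emeasure_finite less_top[symmetric])
      fix x
      show "s (Suc j) x \<le> (1 / N) * indicator A x"
        using s0(2)[of "Suc j" x] by (auto simp: A_def s_def indicator_def)
    qed (rule int)
    also have "\<dots> = measure representing_measure A / N"
      by simp
    also have "\<dots> \<le> L (s j)" using A \<open>N > 0\<close> by (simp add: field_simps)
    finally show ?thesis .
  qed
  have "(\<integral>x. f x \<partial>representing_measure) = (\<Sum>j<Suc K. \<integral>x. s j x \<partial>representing_measure)"
    unfolding sum_s by (rule Bochner_Integration.integral_sum) (rule int)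
  also have "\<dots> = (\<integral>x. s 0 x \<partial>representing_measure) + (\<Sum>j<K. \<integral>x. s (Suc j) x \<partial>representing_measure)"
    by (rule sum.lessThan_Suc_shift)
  \<comment> \<open>The bottom slice has no slice below it and is estimated by its height; this is
    where the error \<open>e\<close> arises.\<close>
  also have "\<dots> \<le> 1 / N + (\<Sum>j<K. L (s j))"
  proof (rule add_mono)
    have "(\<integral>x. s 0 x \<partial>representing_measure) \<le> (\<integral>x. 1 / N \<partial>representing_measure)"
      using int s0 by (intro integral_mono) auto
    then show "(\<integral>x. s 0 x \<partial>representing_measure) \<le> 1 / N" by (simp add: R.prob_space)
  qed (intro sum_mono slice)
  also have "\<dots> \<le> e + (\<Sum>j<Suc K. L (s j))"
    using K nonneg[OF sc[of K] s0(1)] by (simp add: N_def)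
  also have "(\<Sum>j<Suc K. L (s j)) = L f"
    using sum[of "{..<Suc K}" s, OF sc] sum_s by presburger
  finally show "(\<integral>x. f x \<partial>representing_measure) \<le> L f + e" by simp
qed

text \<open>For values between 0 and 1, the one-sided bound for \<open>g\<close> and for
  \<open>1 - g\<close> gives equality. Every continuous function is an affine image of such a
  \<open>g\<close>, being bounded.\<close>

theorem integral_representing_measure:
  assumes cont: "continuous_on UNIV f"
  shows "(\<integral>x. f x \<partial>representing_measure) = L f"
proof -
  interpret R: prob_space representing_measure by (rule prob_space_representing_measure)
  have *: "(\<integral>x. g x \<partial>representing_measure) = L g"
    if g: "continuous_on UNIV g" "\<And>x. 0 \<le> g x" "\<And>x. g x \<le> 1" for g
  proof (rule antisym)
    have [measurable]: "g \<in> borel_measurable borel" by (intro borel_measurable_continuous_onI g)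
    have "integrable representing_measure g"
      by (rule R.integrable_const_bound[where B=1]) (use g in auto)
    then have "1 - (\<integral>x. g x \<partial>representing_measure) = (\<integral>x. 1 - g x \<partial>representing_measure)"
      by (simp add: R.prob_space)
    also have "\<dots> \<le> L (\<lambda>x. 1 - g x)"
      using g by (intro integral_representing_measure_le continuous_intros) auto
    also have "\<dots> = L (\<lambda>x. 1 + (-1) * g x)" by simp
    also have "\<dots> = 1 - L g"
      using g cmult[OF g(1), of "-1"] by (subst add) (auto intro!: continuous_intros simp: const)
    finally show "L g \<le> (\<integral>x. g x \<partial>representing_measure)" by simp
  qed (intro integral_representing_measure_le g)
  have "bounded (range f)" using compact_continuous_image[OF cont compact] by (rule compact_imp_bounded)
  then obtain B where B: "B > 0" "\<And>x. \<bar>f x\<bar> \<le> B" by (auto simp: bounded_pos)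
  define g where "g = (\<lambda>x. (f x + B) / (2 * B))"
  have gc: "continuous_on UNIV g"
    unfolding g_def using B by (intro continuous_intros cont) auto
  have g: "0 \<le> g x" "g x \<le> 1" for x
    using B(1) B(2)[of x] by (auto simp: g_def field_simps abs_le_iff)
  have f: "f = (\<lambda>x. 2 * B * g x + (- B))" using B by (simp add: g_def)
  have [measurable]: "g \<in> borel_measurable borel" by (intro borel_measurable_continuous_onI gc)
  have int: "integrable representing_measure g"
    by (rule R.integrable_const_bound[where B=1]) (use g in auto)
  have "(\<integral>x. f x \<partial>representing_measure) = 2 * B * (\<integral>x. g x \<partial>representing_measure) + (- B)"
    unfolding f using int by (simp add: R.prob_space)
  also have "\<dots> = L (\<lambda>x. 2 * B * g x + (- B))"
    using gc g by (subst add) (auto intro!: continuous_intros simp: const cmult *)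
  finally show ?thesis by (simp only: f[symmetric])
qed

end

section \<open>Separability of the space of continuous functions\<close>

lemma continuous_on_Min:
  fixes f :: "'i \<Rightarrow> 'a::topological_space \<Rightarrow> real"
  assumes "finite F" "F \<noteq> {}" "\<And>p. p \<in> F \<Longrightarrow> continuous_on S (f p)"
  shows "continuous_on S (\<lambda>x. Min ((\<lambda>p. f p x) ` F))"
  using assms
proof (induction F rule: finite_ne_induct)
  case (insert p F)
  then show ?case by (auto intro!: continuous_on_min)
qed simp

lemma continuous_bounded:
  fixes f :: "'a::topological_space \<Rightarrow> real"
  assumes "compact (UNIV :: 'a set)" "continuous_on UNIV f"
  shows "\<exists>B>0. \<forall>x. \<bar>f x\<bar> \<le> B"
proof -
  have "bounded (range f)"
    using compact_continuous_image[OF assms(2,1)] by (rule compact_imp_bounded)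
  then show ?thesis by (auto simp: bounded_pos)
qed

text \<open>Inf-convolution: a continuous \<open>f\<close> is approximated by minima of finitely many cones
  \<open>q p + L \<cdot> dist(x, p)\<close> with rational \<open>q p\<close> close to \<open>f p\<close>, the apexes \<open>p\<close> forming a fine net.\<close>

lemma countable_dense_continuous:
  assumes compact: "compact (UNIV :: 'a::metric_space set)"
  obtains D :: "('a::metric_space \<Rightarrow> real) set" where "countable D" "\<And>f. f \<in> D \<Longrightarrow> continuous_on UNIV f"
    "\<And>f e. continuous_on UNIV f \<Longrightarrow> e > 0 \<Longrightarrow> \<exists>g\<in>D. \<forall>x. \<bar>f x - g x\<bar> \<le> e"
proof -
  have "\<exists>F :: 'a set. finite F \<and> UNIV \<subseteq> (\<Union>p\<in>F. ball p (1 / real (Suc n)))" for n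
    using compact[unfolded compact_eq_totally_bounded] by (meson of_nat_0_less_iff zero_less_Suc zero_less_divide_1_iff)
  then obtain F :: "nat \<Rightarrow> 'a set" where F: "\<And>n. finite (F n)"
    "\<And>n. UNIV \<subseteq> (\<Union>p\<in>F n. ball p (1 / real (Suc n)))" by metis
  have ne: "F n \<noteq> {}" for n using F(2)[of n] by auto
  define G where "G = (\<lambda>n L q x. Min ((\<lambda>p. q p + real L * dist x p) ` F n))"
  \<comment> \<open>Extensional rational-valued functions on a finite set are countably many, hence
    so are the minima of cones.\<close>
  define D where "D = (\<Union>n. \<Union>L. G n L ` (F n \<rightarrow>\<^sub>E \<rat>))"
  show ?thesis
  proof
    show "countable D"
      unfolding D_def by (intro countable_UN countable_image countable_PiE countable_rat F) auto
    fix f assume "f \<in> D"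
    then obtain n L q where f: "f = G n L q" by (auto simp: D_def)
    show "continuous_on UNIV f"
      unfolding f G_def by (intro continuous_on_Min F ne continuous_intros)
  next
    fix f :: "'a \<Rightarrow> real" and e :: real assume cont: "continuous_on UNIV f" and "e > 0"
    obtain B where B: "B > 0" "\<And>x. \<bar>f x\<bar> \<le> B" using continuous_bounded[OF compact cont] by blast
    have "uniformly_continuous_on UNIV f" using cont compact by (rule compact_uniformly_continuous)
    then obtain d where d: "d > 0" "\<And>x y. dist x y < d \<Longrightarrow> dist (f x) (f y) < e / 3"
      using \<open>e > 0\<close> unfolding uniformly_continuous_on_def by (metis UNIV_I zero_less_divide_iff zero_less_numeral)
    \<comment> \<open>With this slope a cone rises by more than \<open>2 * B\<close>, a bound for
      the oscillation of \<open>f\<close>, at distance \<open>d\<close> from its apex. Remote apexes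
      thus cannot pull the minimum below \<open>f\<close>.\<close>
    obtain L :: nat where L: "2 * B / d < real L" using reals_Archimedean2 by blast
    then have Ld: "2 * B < real L * d" using d by (simp add: field_simps)
    \<comment> \<open>The net is finer than \<open>d\<close>, so that \<open>f\<close> hardly
      changes on the way to a nearby apex, and fine enough for a cone to rise by at most
      \<open>e / 3\<close> over that distance.\<close>
    have "min d (e / 3 / (real L + 1)) > 0" using d \<open>e > 0\<close> by simp
    then obtain n where n: "1 / real (Suc n) < min d (e / 3 / (real L + 1))" using nat_approx_posE by metis
    have "\<exists>r\<in>\<rat>. f p < r \<and> r < f p + e / 3" for p using \<open>e > 0\<close> by (intro Rats_dense_in_real) simp
    then obtain q where q: "\<And>p. q p \<in> \<rat>" "\<And>p. f p < q p" "\<And>p. q p < f p + e / 3" by metis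
    let ?q = "restrict q (F n)"
    have "?q \<in> F n \<rightarrow>\<^sub>E \<rat>" using q by auto
    then have "G n L ?q \<in> D" unfolding D_def by blast
    moreover have "\<bar>f x - G n L ?q x\<bar> \<le> e" for x
    proof -
      obtain p where p: "p \<in> F n" "dist p x < 1 / real (Suc n)" using F(2)[of n] by (auto simp: subset_iff)
      have pd: "dist p x < d" using p n by simp
      have "G n L ?q x \<le> ?q p + real L * dist x p"
        unfolding G_def using p F by (intro Min_le) auto
      also have "\<dots> = q p + real L * dist x p" using p by simp
      also have "real L * dist x p \<le> e / 3"
      proof -
        have "real L * dist x p \<le> (real L + 1) * (e / 3 / (real L + 1))"
          using p n by (intro mult_mono) (auto simp: dist_commute)
        moreover have "a * (b / a) = b" if "a > 0" for a b :: real using that by simp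
        from this[of "real L + 1" "e / 3"] have "(real L + 1) * (e / 3 / (real L + 1)) = e / 3" by simp
        ultimately show ?thesis by linarith
      qed
      also have "q p + e / 3 < f p + e / 3 + e / 3" using q(3)[of p] by simp
      also have "f p < f x + e / 3" using d(2)[OF pd] unfolding dist_real_def by linarith
      finally have upper: "G n L ?q x \<le> f x + e" by simp
      have "f x - e \<le> G n L ?q x"
        unfolding G_def
      proof (rule Min.boundedI)
        fix a assume "a \<in> (\<lambda>p. ?q p + real L * dist x p) ` F n"
        then obtain r where r: "r \<in> F n" "a = q r + real L * dist x r" by auto
        show "f x - e \<le> a"
        proof (cases "dist x r < d")
          case True
          then have "f x < f r + e / 3" using d(2)[OF True] unfolding dist_real_def by linarith
          moreover have "0 \<le> real L * dist x r" by simp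
          ultimately show ?thesis using r q(2)[of r] \<open>e > 0\<close> by linarith
        next
          case False
          then have "real L * d \<le> real L * dist x r" by (intro mult_left_mono) auto
          then show ?thesis using r q(2)[of r] Ld B(2)[of x] B(2)[of r] \<open>e > 0\<close> by linarith
        qed
      qed (use F ne in auto)
      with upper show ?thesis by linarith
    qed
    ultimately show "\<exists>g\<in>D. \<forall>x. \<bar>f x - g x\<bar> \<le> e" by blast
  qed
qed

section \<open>Ergodic measures and the ergodic support\<close>

text \<open>The empirical measure is the image of the uniform distribution on the time indices, so
  repeated orbit points are counted with the right multiplicity.\<close>

lemma integral_empirical_measure:
  fixes f :: "'a::topological_space \<Rightarrow> real"
  assumes [measurable]: "f \<in> borel_measurable borel" and "n > 0"
  shows "(\<integral>x. f x \<partial>empirical_measure T x0 n) = birkhoff_average T f n x0"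
proof -
  let ?p = "pmf_of_set {..<n}" and ?h = "\<lambda>k. (T ^^ k) x0"
  have S: "{..<n} \<noteq> {}" "finite {..<n}" using \<open>n > 0\<close> by (auto simp: lessThan_empty_iff)
  have "empirical_measure T x0 n = distr (measure_pmf ?p) borel ?h"
  proof (rule measure_eqI)
    fix A assume "A \<in> sets (empirical_measure T x0 n)"
    then have A: "A \<in> sets borel" by simp
    have "(\<Sum>k<n. emeasure (return borel (?h k)) A) = of_nat (card ({..<n} \<inter> ?h -` A))"
      using A by (simp add: indicator_def sum.If_cases vimage_def)
    then have "emeasure (empirical_measure T x0 n) A = ennreal (1 / real n) * of_nat (card ({..<n} \<inter> ?h -` A))"
      by (simp only: emeasure_empirical_measure[OF A])
    also have "\<dots> = ennreal (real (card ({..<n} \<inter> ?h -` A)) / real n)"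
      by (simp add: ennreal_of_nat_eq_real_of_nat ennreal_mult''[symmetric])
    also have "\<dots> = emeasure (distr (measure_pmf ?p) borel ?h) A"
      using A S by (simp add: emeasure_distr emeasure_pmf_of_set)
    finally show "emeasure (empirical_measure T x0 n) A = emeasure (distr (measure_pmf ?p) borel ?h) A" .
  qed simp
  then have "(\<integral>x. f x \<partial>empirical_measure T x0 n) = (\<integral>k. f (?h k) \<partial>measure_pmf ?p)"
    by (simp add: integral_distr)
  also have "\<dots> = birkhoff_average T f n x0"
    using S by (simp add: integral_pmf_of_set birkhoff_average_def)
  finally show ?thesis .
qed

lemma basin_iff:
  "x \<in> basin T \<nu> \<longleftrightarrow>
    (\<forall>f :: 'a::topological_space \<Rightarrow> real. continuous_on UNIV f \<longrightarrow>
      (\<lambda>n. birkhoff_average T f n x) \<longlonglongrightarrow> (\<integral>y. f y \<partial>\<nu>))"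
proof -
  have "((\<lambda>n. \<integral>y. f y \<partial>empirical_measure T x n) \<longlonglongrightarrow> c) \<longleftrightarrow> ((\<lambda>n. birkhoff_average T f n x) \<longlonglongrightarrow> c)"
    if "continuous_on UNIV f" for f :: "'a \<Rightarrow> real" and c
    by (rule tendsto_cong)
      (auto intro!: eventually_sequentiallyI[of 1] integral_empirical_measure borel_measurable_continuous_onI[OF that])
  then show ?thesis by (auto simp: basin_def weakly_converges_def)
qed

lemma continuous_on_birkhoff_average:
  fixes T :: "'a::topological_space \<Rightarrow> 'a"
  assumes T: "continuous_on UNIV T" and f: "continuous_on UNIV f"
  shows "continuous_on UNIV (birkhoff_average T f n)"
proof -
  have "continuous_on UNIV (T ^^ k)" for k
  proof (induction k)
    case (Suc k)
    then show ?case using continuous_on_compose[of UNIV "T ^^ k" T] T by (simp add: continuous_on_subset)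
  qed (simp add: id_def)
  then have "continuous_on UNIV (\<lambda>x. f ((T ^^ k) x))" for k
    by (rule continuous_on_compose2[OF f]) simp
  then show ?thesis
    unfolding birkhoff_average_def[abs_def]
    by (cases "n = 0") (auto intro!: continuous_on_divide continuous_on_sum)
qed

lemma birkhoff_average_abs_diff_le:
  assumes "\<And>x. \<bar>f x - g x\<bar> \<le> e"
  shows "\<bar>birkhoff_average T f n x - birkhoff_average T g n x\<bar> \<le> e"
proof -
  have "birkhoff_average T f n x - birkhoff_average T g n x = birkhoff_average T (\<lambda>x. f x - g x) n x"
    by (simp add: birkhoff_average_def sum_subtractf diff_divide_distrib)
  then show ?thesis using birkhoff_average_bounded[where f="\<lambda>x. f x - g x", OF assms] by simp
qed

text \<open>A uniform error in the function is an equal error bound for all averages, so the Cauchy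
  property survives approximation. This carries convergence from the countable dense set to every
  continuous function.\<close>

lemma birkhoff_average_convergent_approx:
  assumes "\<And>e. e > 0 \<Longrightarrow> \<exists>g. (\<forall>x. \<bar>f x - g x\<bar> \<le> e) \<and> convergent (\<lambda>n. birkhoff_average T g n x)"
  shows "convergent (\<lambda>n. birkhoff_average T f n x)"
proof -
  have "Cauchy (\<lambda>n. birkhoff_average T f n x)"
  proof (rule metric_CauchyI)
    fix e :: real assume "e > 0"
    then obtain g where g: "\<And>x. \<bar>f x - g x\<bar> \<le> e / 4" "convergent (\<lambda>n. birkhoff_average T g n x)"
      using assms[of "e / 4"] by auto
    have "Cauchy (\<lambda>n. birkhoff_average T g n x)" using g(2) by (rule convergent_Cauchy)
    moreover have "e / 4 > 0" using \<open>e > 0\<close> by simp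
    ultimately obtain N where N:
      "\<And>m n. m \<ge> N \<Longrightarrow> n \<ge> N \<Longrightarrow> dist (birkhoff_average T g m x) (birkhoff_average T g n x) < e / 4"
      by (metis metric_CauchyD)
    have "dist (birkhoff_average T f m x) (birkhoff_average T f n x) < e" if "m \<ge> N" "n \<ge> N" for m n
      using N[OF that] birkhoff_average_abs_diff_le[where f=f and g=g and T=T and x=x and n=m, OF g(1)]
        birkhoff_average_abs_diff_le[where f=f and g=g and T=T and x=x and n=n, OF g(1)] \<open>e > 0\<close>
      unfolding dist_real_def by linarith
    then show "\<exists>N. \<forall>m\<ge>N. \<forall>n\<ge>N. dist (birkhoff_average T f m x) (birkhoff_average T f n x) < e" by blast
  qed
  then show ?thesis by (simp add: Cauchy_convergent_iff)
qed

lemma measure_preserving_system_iff_invariant: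
  assumes "continuous_on UNIV T"
  shows "\<nu> \<in> invariant_measures T \<longleftrightarrow> sets \<nu> = sets borel \<and> measure_preserving_system \<nu> T"
proof -
  have T[measurable]: "T \<in> borel \<rightarrow>\<^sub>M borel" using assms by (rule borel_measurable_continuous_onI)
  have "measure_preserving_system \<nu> T \<longleftrightarrow> prob_space \<nu> \<and> (\<forall>A\<in>sets borel. emeasure \<nu> (T -` A) = emeasure \<nu> A)"
    if sets: "sets \<nu> = sets borel"
  proof -
    note [measurable_cong] = sets
    have "space \<nu> = UNIV" using sets_eq_imp_space_eq[OF sets] by simp
    moreover have "T \<in> \<nu> \<rightarrow>\<^sub>M \<nu>" by measurable
    ultimately have em: "emeasure (distr \<nu> \<nu> T) A = emeasure \<nu> (T -` A)" if "A \<in> sets borel" for A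
      using that sets by (simp add: emeasure_distr)
    have "distr \<nu> \<nu> T = \<nu> \<longleftrightarrow> (\<forall>A\<in>sets borel. emeasure \<nu> (T -` A) = emeasure \<nu> A)"
    proof
      assume "distr \<nu> \<nu> T = \<nu>"
      then show "\<forall>A\<in>sets borel. emeasure \<nu> (T -` A) = emeasure \<nu> A" by (metis em)
    next
      assume "\<forall>A\<in>sets borel. emeasure \<nu> (T -` A) = emeasure \<nu> A"
      then show "distr \<nu> \<nu> T = \<nu>" by (intro measure_eqI) (simp_all add: em sets)
    qed
    with \<open>T \<in> \<nu> \<rightarrow>\<^sub>M \<nu>\<close> show ?thesis
      by (simp add: measure_preserving_system_def measure_preserving_system_axioms_def)
  qed
  then show ?thesis by (auto simp: invariant_measures_def borel_prob_measures_def)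
qed

section \<open>Ergodicity and vanishing variance\<close>

locale compact_system =
  fixes T :: "'a::metric_space \<Rightarrow> 'a"
  assumes compact: "compact (UNIV :: 'a set)"
    and T_continuous: "continuous_on UNIV T"
begin

text \<open>A single invariant set suffices, the points where \<open>F\<close> exceeds its mean
  \<open>c\<close>. Full measure would make the integral exceed \<open>c\<close>, so it is null;
  then \<open>c - F\<close> is nonnegative almost everywhere with integral 0.\<close>

lemma ergodic_AE_const:
  fixes F :: "'a \<Rightarrow> real"
  assumes \<nu>: "\<nu> \<in> ergodic_measures T"
    and [measurable]: "F \<in> borel_measurable borel"
    and B: "\<And>x. \<bar>F x\<bar> \<le> B" and inv: "\<And>x. F (T x) = F x"
  shows "AE x in \<nu>. F x = (\<integral>y. F y \<partial>\<nu>)"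
proof -
  from \<nu> have "\<nu> \<in> invariant_measures T" by (simp add: ergodic_measures_def)
  then have sets[measurable_cong]: "sets \<nu> = sets borel" and "measure_preserving_system \<nu> T"
    using measure_preserving_system_iff_invariant[OF T_continuous] by auto
  then interpret measure_preserving_system \<nu> T by simp
  have space: "space \<nu> = UNIV" using sets_eq_imp_space_eq[OF sets] by simp
  define c where "c = (\<integral>y. F y \<partial>\<nu>)"
  have int: "integrable \<nu> F" by (rule integrable_bounded[OF _ B]) measurable
  define A where "A = {x. F x > c}"
  have [measurable]: "A \<in> sets borel" unfolding A_def by measurable
  have "T -` A = A" using inv by (auto simp: A_def)
  with \<nu> have "emeasure \<nu> A = 0 \<or> emeasure \<nu> A = 1" by (auto simp: ergodic_measures_def)
  moreover have "emeasure \<nu> A \<noteq> 1"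
  proof
    assume "emeasure \<nu> A = 1"
    then have "AE x in \<nu>. x \<in> A"
      using AE_iff_emeasure_eq_1[of "\<lambda>x. x \<in> A"] by (simp add: space)
    then have "AE x in \<nu>. c < F x" by eventually_elim (simp add: A_def)
    then have "(\<integral>x. c \<partial>\<nu>) < (\<integral>x. F x \<partial>\<nu>)"
      using int by (intro integral_less_AE_space) (auto simp: emeasure_space_1)
    then show False by (simp add: c_def prob_space)
  qed
  ultimately have "AE x in \<nu>. x \<notin> A" by (intro AE_not_in) (auto simp: null_sets_def sets)
  then have "AE x in \<nu>. 0 \<le> c - F x" by eventually_elim (simp add: A_def)
  moreover have "(\<integral>x. c - F x \<partial>\<nu>) = 0" using int by (simp add: c_def prob_space)
  ultimately have "AE x in \<nu>. c - F x = 0"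
    using int by (subst (asm) integral_nonneg_eq_0_iff_AE) auto
  then show ?thesis unfolding c_def[symmetric] by eventually_elim simp
qed

text \<open>The second moments of the averages tend to that of the Birkhoff limit, which ergodicity
  makes equal to the mean of \<open>f\<close> almost everywhere.\<close>

lemma ergodic_variance_less:
  assumes \<nu>: "\<nu> \<in> ergodic_measures T" and f: "continuous_on UNIV f" and "e > 0"
  shows "\<exists>m. (\<integral>x. (birkhoff_average T f (Suc m) x)\<^sup>2 \<partial>\<nu>) < (\<integral>x. f x \<partial>\<nu>)\<^sup>2 + e"
proof -
  from \<nu> have "\<nu> \<in> invariant_measures T" by (simp add: ergodic_measures_def)
  then have sets[measurable_cong]: "sets \<nu> = sets borel" and "measure_preserving_system \<nu> T"
    using measure_preserving_system_iff_invariant[OF T_continuous] by auto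
  then interpret measure_preserving_system \<nu> T by simp
  obtain B where B: "B > 0" "\<And>x. \<bar>f x\<bar> \<le> B"
      using continuous_bounded[OF compact f] by blast
  have [measurable]: "f \<in> borel_measurable borel" using f by (rule borel_measurable_continuous_onI)
  have fM: "f \<in> borel_measurable \<nu>" by measurable
  have Fm: "birkhoff_limit T f \<in> borel_measurable borel"
    using birkhoff_limit_measurable[OF fM] measurable_cong_sets[OF sets refl, of borel] by blast
  have "AE x in \<nu>. birkhoff_limit T f x = (\<integral>y. birkhoff_limit T f y \<partial>\<nu>)"
    by (rule ergodic_AE_const[OF \<nu> Fm limsup_birkhoff_average(2)[where f=f, OF B(2)]
      birkhoff_limit_invariant[where f=f, OF B(2)]])
  then have "(\<integral>x. (birkhoff_limit T f x)\<^sup>2 \<partial>\<nu>) = (\<integral>x. (\<integral>y. f y \<partial>\<nu>)\<^sup>2 \<partial>\<nu>)"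
    using birkhoff_limit_measurable[OF fM] unfolding birkhoff(2)[OF fM B(2)]
    by (intro integral_cong_AE) auto
  then have "(\<lambda>m. \<integral>x. (birkhoff_average T f (Suc m) x)\<^sup>2 \<partial>\<nu>) \<longlonglongrightarrow> (\<integral>y. f y \<partial>\<nu>)\<^sup>2"
    using birkhoff_average_L2_tendsto[OF fM B(2)] by (simp add: prob_space)
  then have "\<forall>\<^sub>F m in sequentially. (\<integral>x. (birkhoff_average T f (Suc m) x)\<^sup>2 \<partial>\<nu>) < (\<integral>y. f y \<partial>\<nu>)\<^sup>2 + e"
    using \<open>e > 0\<close> by (intro order_tendstoD) auto
  then show ?thesis by (auto simp: eventually_sequentially)
qed

text \<open>The variance hypothesis makes an invariant set \<open>A\<close> uncorrelated with every \<open>f \<in> D\<close>, hence with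
  every continuous function, and finally with its own indicator function.\<close>

lemma ergodicI_variance:
  assumes \<nu>: "\<nu> \<in> invariant_measures T"
    and D: "\<And>f. f \<in> D \<Longrightarrow> continuous_on UNIV f"
    and dense: "\<And>f e. continuous_on UNIV f \<Longrightarrow> e > 0 \<Longrightarrow> \<exists>g\<in>D. \<forall>x. \<bar>f x - g x\<bar> \<le> e"
    and var: "\<And>f e. f \<in> D \<Longrightarrow> e > 0 \<Longrightarrow>
      \<exists>m. (\<integral>x. (birkhoff_average T f (Suc m) x)\<^sup>2 \<partial>\<nu>) < (\<integral>x. f x \<partial>\<nu>)\<^sup>2 + e"
  shows "\<nu> \<in> ergodic_measures T"
  unfolding ergodic_measures_def
proof (intro CollectI conjI ballI impI)
  from \<nu> have sets[measurable_cong]: "sets \<nu> = sets borel" and "measure_preserving_system \<nu> T"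
    using measure_preserving_system_iff_invariant[OF T_continuous] by auto
  then interpret measure_preserving_system \<nu> T by simp
  have space: "space \<nu> = UNIV" using sets_eq_imp_space_eq[OF sets] by simp
  have cont_meas: "f \<in> borel_measurable \<nu>" if "continuous_on UNIV f" for f :: "'a \<Rightarrow> real"
    using borel_measurable_continuous_onI[OF that] by measurable
  fix A assume A[measurable]: "A \<in> sets borel" and TA: "T -` A = A"
  have A_funpow: "(T ^^ k) x \<in> A \<longleftrightarrow> x \<in> A" for k x
    using TA by (induction k) auto
  have on_D: "(\<integral>x. indicator A x * f x \<partial>\<nu>) = measure \<nu> A * (\<integral>x. f x \<partial>\<nu>)" if f: "f \<in> D" for f
  proof -
    define c where "c = (\<integral>x. f x \<partial>\<nu>)"
    note fM[measurable] = cont_meas[OF D[OF f]]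
    obtain B where B: "B > 0" "\<And>x. \<bar>f x\<bar> \<le> B"
      using continuous_bounded[OF compact D[OF f]] by blast
    \<comment> \<open>The covariance of \<open>f\<close> and the indicator of
      \<open>A\<close>.\<close>
    define d where "d = (\<integral>x. indicator A x * f x \<partial>\<nu>) - c * measure \<nu> A"
    have d_le: "d\<^sup>2 \<le> e" if "e > 0" for e
    proof -
      obtain m where m: "(\<integral>x. (birkhoff_average T f (Suc m) x)\<^sup>2 \<partial>\<nu>) < c\<^sup>2 + e"
        using var[OF f \<open>e > 0\<close>] by (auto simp: c_def)
      let ?g = "birkhoff_average T f (Suc m)"
      have gB: "\<bar>?g x\<bar> \<le> B" for x by (rule birkhoff_average_bounded[where f=f, OF B(2)])
      have g2B: "\<bar>(?g x)\<^sup>2\<bar> \<le> B\<^sup>2" for x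
        using power_mono[OF gB[of x] abs_ge_zero, of 2] by simp
      have AB: "\<bar>indicator A x * f x\<bar> \<le> B" "\<bar>indicator A x * ?g x\<bar> \<le> B" for x
        using B(1) B(2)[of x] gB[of x] by (auto simp: indicator_def)
      have int: "integrable \<nu> ?g" "integrable \<nu> (\<lambda>x. (?g x)\<^sup>2)" "integrable \<nu> (\<lambda>x. indicator A x * ?g x)"
        "integrable \<nu> (\<lambda>x. indicator A x :: real)"
        by (rule integrable_bounded[OF _ gB] integrable_bounded[OF _ g2B] integrable_bounded[OF _ AB(2)]
          integrable_bounded[where B=1]; simp)+
      \<comment> \<open>Orbits do not cross the boundary of the invariant set \<open>A\<close>, so
        its indicator can be moved inside the average. Hence \<open>d\<close> is also the covariance
        with \<open>?g\<close>, whose variance is below \<open>e\<close>.\<close>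
      have "indicator A x * ?g x = birkhoff_average T (\<lambda>x. indicator A x * f x) (Suc m) x" for x
        by (simp add: birkhoff_average_def sum_distrib_left indicator_def A_funpow)
      then have "(\<integral>x. indicator A x * ?g x \<partial>\<nu>) = (\<integral>x. indicator A x * f x \<partial>\<nu>)"
        using integral_birkhoff_average[where f="\<lambda>x. indicator A x * f x", OF _ AB(1)] by simp
      then have d: "d = (\<integral>x. indicator A x * (?g x - c) \<partial>\<nu>)"
        using int by (simp add: d_def right_diff_distrib space)
      let ?h = "\<lambda>x. indicator A x * (?g x - c)"
      have gcB: "\<bar>(?g x - c)\<^sup>2\<bar> \<le> (B + \<bar>c\<bar>)\<^sup>2" for x
      proof -
        have "\<bar>?g x - c\<bar> \<le> B + \<bar>c\<bar>" using gB[of x] by linarith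
        from power_mono[OF this abs_ge_zero, of 2] show ?thesis by simp
      qed
      have h2: "(?h x)\<^sup>2 \<le> (?g x - c)\<^sup>2" for x by (simp add: indicator_def)
      have h2B: "\<bar>(?h x)\<^sup>2\<bar> \<le> (B + \<bar>c\<bar>)\<^sup>2" for x using h2[of x] gcB[of x] by simp
      have hB: "\<bar>?h x\<bar> \<le> B + \<bar>c\<bar>" for x using gB[of x] B by (auto simp: indicator_def)
      have int2: "integrable \<nu> ?h" "integrable \<nu> (\<lambda>x. (?h x)\<^sup>2)" "integrable \<nu> (\<lambda>x. (?g x - c)\<^sup>2)"
        by (rule integrable_bounded[OF _ hB] integrable_bounded[OF _ h2B] integrable_bounded[OF _ gcB]; simp)+
      \<comment> \<open>Cauchy-Schwarz, in the form that the variance of \<open>?h\<close> is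
        nonnegative.\<close>
      have "d\<^sup>2 \<le> (\<integral>x. (?h x)\<^sup>2 \<partial>\<nu>)"
        using variance_eq[OF int2(1,2)] variance_positive[of ?h] by (simp add: d)
      also have "\<dots> \<le> (\<integral>x. (?g x - c)\<^sup>2 \<partial>\<nu>)"
        using int2 h2 by (intro integral_mono)
      also have "\<dots> = (\<integral>x. (?g x)\<^sup>2 \<partial>\<nu>) - 2 * c * (\<integral>x. ?g x \<partial>\<nu>) + c\<^sup>2"
        using int by (simp add: power2_diff prob_space mult.assoc mult.commute[of _ c])
      also have "(\<integral>x. ?g x \<partial>\<nu>) = c"
        using integral_birkhoff_average[OF fM B(2)] by (simp add: c_def)
      finally show ?thesis using m by (simp add: power2_eq_square)
    qed
    have "d\<^sup>2 \<le> 0"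
    proof (rule field_le_epsilon)
      fix e :: real assume "0 < e"
      from d_le[OF this] show "d\<^sup>2 \<le> 0 + e" by simp
    qed
    then show ?thesis by (simp add: d_def c_def)
  qed
  have corr: "(\<integral>x. indicator A x * f x \<partial>\<nu>) = measure \<nu> A * (\<integral>x. f x \<partial>\<nu>)" if f: "continuous_on UNIV f" for f
  proof -
    obtain B where B: "B > 0" "\<And>x. \<bar>f x\<bar> \<le> B"
      using continuous_bounded[OF compact f] by blast
    note [measurable] = cont_meas[OF f]
    define d where "d = (\<integral>x. indicator A x * f x \<partial>\<nu>) - measure \<nu> A * (\<integral>x. f x \<partial>\<nu>)"
    have d_le: "\<bar>d\<bar> \<le> 2 * e" if "e > 0" for e
    proof -
      obtain g where g: "g \<in> D" "\<And>x. \<bar>f x - g x\<bar> \<le> e" using dense[OF f \<open>e > 0\<close>] by blast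
      note [measurable] = cont_meas[OF D[OF g(1)]]
      have gB: "\<bar>g x\<bar> \<le> B + e" for x using B(2)[of x] g(2)[of x] by linarith
      have AB: "\<bar>indicator A x * f x\<bar> \<le> B" "\<bar>indicator A x * g x\<bar> \<le> B + e" for x
        using B(1) B(2)[of x] gB[of x] \<open>e > 0\<close> by (auto simp: indicator_def)
      have int: "integrable \<nu> f" "integrable \<nu> g"
        "integrable \<nu> (\<lambda>x. indicator A x * f x)" "integrable \<nu> (\<lambda>x. indicator A x * g x)"
        by (rule integrable_bounded[OF _ B(2)] integrable_bounded[OF _ gB]
          integrable_bounded[OF _ AB(1)] integrable_bounded[OF _ AB(2)]; simp)+
      have "\<bar>\<integral>x. f x - g x \<partial>\<nu>\<bar> \<le> (\<integral>x. e \<partial>\<nu>)"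
        using int g(2) by (intro integral_abs_bound[THEN order_trans] integral_mono) auto
      then have 1: "\<bar>(\<integral>x. f x \<partial>\<nu>) - (\<integral>x. g x \<partial>\<nu>)\<bar> \<le> e" using int by (simp add: prob_space)
      have "\<bar>\<integral>x. indicator A x * f x - indicator A x * g x \<partial>\<nu>\<bar> \<le> (\<integral>x. e \<partial>\<nu>)"
        using int g(2) \<open>e > 0\<close>
        by (intro integral_abs_bound[THEN order_trans] integral_mono) (auto simp: indicator_def)
      then have 2: "\<bar>(\<integral>x. indicator A x * f x \<partial>\<nu>) - (\<integral>x. indicator A x * g x \<partial>\<nu>)\<bar> \<le> e"
        using int by (simp add: prob_space)
      have "measure \<nu> A * \<bar>(\<integral>x. f x \<partial>\<nu>) - (\<integral>x. g x \<partial>\<nu>)\<bar> \<le> 1 * e"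
        using 1 by (intro mult_mono) auto
      then have "\<bar>measure \<nu> A * (\<integral>x. f x \<partial>\<nu>) - measure \<nu> A * (\<integral>x. g x \<partial>\<nu>)\<bar> \<le> e"
        by (simp add: right_diff_distrib[symmetric] abs_mult)
      with 2 on_D[OF g(1)] show ?thesis unfolding d_def by linarith
    qed
    have "\<bar>d\<bar> \<le> 0"
    proof (rule field_le_epsilon)
      fix e :: real assume "0 < e"
      then show "\<bar>d\<bar> \<le> 0 + e" using d_le[of "e / 2"] by simp
    qed
    then show ?thesis by (simp add: d_def)
  qed
  \<comment> \<open>By \<open>corr\<close> these two finite measures give every continuous function
    the same integral, so they coincide. Evaluated at \<open>A\<close> itself, this says that the
    measure of \<open>A\<close> equals its own square.\<close>
  let ?N1 = "density \<nu> (\<lambda>x. ennreal (indicator A x))" and ?N2 = "density \<nu> (\<lambda>x. ennreal (measure \<nu> A))"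
  have em1: "emeasure ?N1 E = emeasure \<nu> (A \<inter> E)" if "E \<in> sets borel" for E
    using that by (simp add: emeasure_density sets ennreal_indicator indicator_inter_arith[symmetric] space)
  have em2: "emeasure ?N2 E = ennreal (measure \<nu> A) * emeasure \<nu> E" if "E \<in> sets borel" for E
    using that by (simp add: emeasure_density_const sets)
  have "?N1 = ?N2"
  proof (rule measure_eqI_continuous)
    show "finite_measure ?N1"
      by (rule finite_measureI) (use em1[of UNIV] in \<open>simp add: space emeasure_eq_measure\<close>)
    show "finite_measure ?N2"
      by (rule finite_measureI) (use em2[of UNIV] in \<open>simp add: space emeasure_eq_measure ennreal_mult''[symmetric]\<close>)
    fix f :: "'a \<Rightarrow> real" assume f: "continuous_on UNIV f"
    note [measurable] = cont_meas[OF f]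
    show "(\<integral>x. f x \<partial>?N1) = (\<integral>x. f x \<partial>?N2)"
      using corr[OF f] by (simp add: integral_real_density)
  qed (simp_all add: sets)
  then have "emeasure \<nu> A = ennreal (measure \<nu> A) * emeasure \<nu> A"
    using em1[OF A] em2[OF A] by simp
  then have "measure \<nu> A = measure \<nu> A * measure \<nu> A"
    by (simp add: emeasure_eq_measure ennreal_mult''[symmetric])
  then show "emeasure \<nu> A = 0 \<or> emeasure \<nu> A = 1"
    by (auto simp: emeasure_eq_measure)
qed (rule \<nu>)

text \<open>The first condition says that the empirical measures of \<open>x\<close> converge, to \<open>\<nu>\<close> say; the second
  one then says that the averages \<open>A\<^sub>m f\<close> have arbitrarily small variance under \<open>\<nu>\<close>. Both only
  involve the Birkhoff averages at \<open>x\<close> of countably many functions.\<close>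

definition regular_points :: "('a \<Rightarrow> real) set \<Rightarrow> 'a set" where
  "regular_points D = {x. \<forall>f\<in>D. convergent (\<lambda>n. birkhoff_average T f n x) \<and>
    (\<forall>j. \<exists>m. birkhoff_limit T (\<lambda>y. (birkhoff_average T f (Suc m) y)\<^sup>2) x <
      (birkhoff_limit T f x)\<^sup>2 + 1 / real (Suc j))}"

text \<open>Both \<open>f\<close> and the squares of its averages are continuous, so at a point of
  the basin their Birkhoff limits are integrals against the ergodic measure. The second condition
  then becomes \<open>ergodic_variance_less\<close>.\<close>

lemma ergodic_support_subset_regular_points:
  assumes D: "\<And>f. f \<in> D \<Longrightarrow> continuous_on UNIV f"
  shows "ergodic_support T \<subseteq> regular_points D"
  unfolding ergodic_support_def
proof
  fix x assume "x \<in> (\<Union>\<nu>\<in>ergodic_measures T. basin T \<nu>)"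
  then obtain \<nu> where \<nu>: "\<nu> \<in> ergodic_measures T" and x: "x \<in> basin T \<nu>" by blast
  have lim: "(\<lambda>n. birkhoff_average T f n x) \<longlonglongrightarrow> (\<integral>y. f y \<partial>\<nu>)" if "continuous_on UNIV f" for f
    using x that by (simp add: basin_iff)
  show "x \<in> regular_points D"
    unfolding regular_points_def
  proof (intro CollectI ballI conjI allI)
    fix f j assume "f \<in> D"
    then have f: "continuous_on UNIV f" by (rule D)
    show "convergent (\<lambda>n. birkhoff_average T f n x)" using lim[OF f] by (rule convergentI)
    have "continuous_on UNIV (\<lambda>y. (birkhoff_average T f (Suc m) y)\<^sup>2)" for m
      by (intro continuous_on_power continuous_on_birkhoff_average T_continuous f)
    then have "birkhoff_limit T (\<lambda>y. (birkhoff_average T f (Suc m) y)\<^sup>2) x =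
        (\<integral>y. (birkhoff_average T f (Suc m) y)\<^sup>2 \<partial>\<nu>)" for m
      by (intro birkhoff_limit_eq lim)
    then show "\<exists>m. birkhoff_limit T (\<lambda>y. (birkhoff_average T f (Suc m) y)\<^sup>2) x <
        (birkhoff_limit T f x)\<^sup>2 + 1 / real (Suc j)"
      using ergodic_variance_less[OF \<nu> f, of "1 / real (Suc j)"] birkhoff_limit_eq[OF lim[OF f]] by simp
  qed
qed

lemma regular_points_subset_ergodic_support:
  assumes D: "\<And>f. f \<in> D \<Longrightarrow> continuous_on UNIV f"
    and dense: "\<And>f e. continuous_on UNIV f \<Longrightarrow> e > 0 \<Longrightarrow> \<exists>g\<in>D. \<forall>x. \<bar>f x - g x\<bar> \<le> e"
  shows "regular_points D \<subseteq> ergodic_support T"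
proof
  fix x assume x: "x \<in> regular_points D"
  define L where "L = (\<lambda>f. birkhoff_limit T f x)"
  have lim: "(\<lambda>n. birkhoff_average T f n x) \<longlonglongrightarrow> L f" if "continuous_on UNIV f" for f
  proof -
    have "convergent (\<lambda>n. birkhoff_average T f n x)"
      using x dense[OF that] by (intro birkhoff_average_convergent_approx) (force simp: regular_points_def)
    then obtain c where c: "(\<lambda>n. birkhoff_average T f n x) \<longlonglongrightarrow> c" by (auto simp: convergent_def)
    with birkhoff_limit_eq[OF c] show ?thesis by (simp add: L_def)
  qed
  have L_eq: "L f = c" if "(\<lambda>n. birkhoff_average T f n x) \<longlonglongrightarrow> c" for f c
    unfolding L_def using that by (rule birkhoff_limit_eq)
  interpret L: normalized_positive_functional L
  proof
    show "L (\<lambda>x. f x + g x) = L f + L g" if "continuous_on UNIV f" "continuous_on UNIV g" for f g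
      by (rule L_eq) (simp only: birkhoff_average_add tendsto_add lim that)
    show "L (\<lambda>x. c * f x) = c * L f" if "continuous_on UNIV f" for f c
      by (rule L_eq) (simp only: birkhoff_average_cmult tendsto_mult_left lim that)
    show "0 \<le> L f" if "continuous_on UNIV f" "\<And>x. 0 \<le> f x" for f
      using lim[OF that(1)] by (rule LIMSEQ_le_const)
        (auto simp: birkhoff_average_def intro!: sum_nonneg divide_nonneg_nonneg that(2))
    have "(\<lambda>n. birkhoff_average T (\<lambda>x. 1) n x) \<longlonglongrightarrow> 1"
      by (intro tendsto_eventually eventually_sequentiallyI[of 1] birkhoff_average_const) simp
    then show "L (\<lambda>x. 1) = 1" by (rule L_eq)
  qed (rule compact)
  define \<nu> where "\<nu> = L.representing_measure"
  interpret prob_space \<nu> unfolding \<nu>_def by (rule L.prob_space_representing_measure)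
  have sets[measurable_cong]: "sets \<nu> = sets borel" by (simp add: \<nu>_def)
  have int: "(\<integral>y. f y \<partial>\<nu>) = L f" if "continuous_on UNIV f" for f
    unfolding \<nu>_def using that by (rule L.integral_representing_measure)
  have T[measurable]: "T \<in> borel \<rightarrow>\<^sub>M borel" using T_continuous by (rule borel_measurable_continuous_onI)
  have T_meas: "T \<in> \<nu> \<rightarrow>\<^sub>M \<nu>" by measurable
  \<comment> \<open>Averages started at \<open>x\<close> and at \<open>T x\<close> have the same
    limit, so \<open>L\<close> does not change under composition with \<open>T\<close>; continuous
    functions determine the measure.\<close>
  have "distr \<nu> \<nu> T = \<nu>"
  proof (rule measure_eqI_continuous)
    show "finite_measure (distr \<nu> \<nu> T)" using T_meas by (rule finite_measure_distr)
    fix f :: "'a \<Rightarrow> real" assume f: "continuous_on UNIV f"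
    have fT: "continuous_on UNIV (\<lambda>y. f (T y))"
      using f T_continuous by (rule continuous_on_compose2) simp
    obtain B where B: "\<And>y. \<bar>f y\<bar> \<le> B" using continuous_bounded[OF compact f] by blast
    have "(\<lambda>n. birkhoff_average T f n (T x)) \<longlonglongrightarrow> L f"
      using birkhoff_average_shift_tendsto[where f=f and k=1, OF B lim[OF f]] by simp
    moreover have "birkhoff_average T f n (T x) = birkhoff_average T (\<lambda>y. f (T y)) n x" for n
      by (simp add: birkhoff_average_def funpow_swap1)
    ultimately have "L (\<lambda>y. f (T y)) = L f"
      using lim[OF fT] by (simp add: LIMSEQ_unique)
    moreover have "f \<in> borel_measurable \<nu>"
      using borel_measurable_continuous_onI[OF f] by measurable
    ultimately show "(\<integral>y. f y \<partial>distr \<nu> \<nu> T) = (\<integral>y. f y \<partial>\<nu>)"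
      by (simp add: integral_distr[OF T_meas] int f fT)
  qed (simp_all add: sets finite_measure_axioms)
  with T_meas have inv: "\<nu> \<in> invariant_measures T"
    by (simp add: measure_preserving_system_iff_invariant[OF T_continuous] sets prob_space_axioms
      measure_preserving_system_def measure_preserving_system_axioms_def)
  have "\<nu> \<in> ergodic_measures T"
  proof (rule ergodicI_variance[OF inv D dense])
    fix f :: "'a \<Rightarrow> real" and e :: real assume f: "f \<in> D" and "e > 0"
    then obtain j where j: "1 / real (Suc j) < e" using nat_approx_posE by metis
    obtain m where "L (\<lambda>y. (birkhoff_average T f (Suc m) y)\<^sup>2) < (L f)\<^sup>2 + 1 / real (Suc j)"
      using x f unfolding regular_points_def L_def by blast
    moreover have "continuous_on UNIV (\<lambda>y. (birkhoff_average T f (Suc m) y)\<^sup>2)"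
      by (intro continuous_on_power continuous_on_birkhoff_average T_continuous D f)
    ultimately have "(\<integral>y. (birkhoff_average T f (Suc m) y)\<^sup>2 \<partial>\<nu>) < (\<integral>y. f y \<partial>\<nu>)\<^sup>2 + e"
      using j int D[OF f] by simp
    then show "\<exists>m. (\<integral>y. (birkhoff_average T f (Suc m) y)\<^sup>2 \<partial>\<nu>) < (\<integral>y. f y \<partial>\<nu>)\<^sup>2 + e" ..
  qed
  moreover have "x \<in> basin T \<nu>" using lim int by (simp add: basin_iff)
  ultimately show "x \<in> ergodic_support T" unfolding ergodic_support_def by blast
qed

text \<open>\<open>emeasure\<close> is 0 on nonmeasurable sets, so the claim includes measurability
  of the ergodic support, which is defined as a possibly uncountable union of basins. Equality with
  \<open>regular_points D\<close>, rather than one inclusion, settles this.\<close>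

theorem emeasure_ergodic_support:
  assumes "\<mu> \<in> invariant_measures T"
  shows "emeasure \<mu> (ergodic_support T) = 1"
proof -
  from assms have sets[measurable_cong]: "sets \<mu> = sets borel" and "measure_preserving_system \<mu> T"
    using measure_preserving_system_iff_invariant[OF T_continuous] by auto
  then interpret measure_preserving_system \<mu> T by simp
  have space: "space \<mu> = UNIV" using sets_eq_imp_space_eq[OF sets] by simp
  obtain D :: "('a \<Rightarrow> real) set" where D: "countable D" "\<And>f. f \<in> D \<Longrightarrow> continuous_on UNIV f"
    and dense: "\<And>f e. continuous_on UNIV f \<Longrightarrow> e > 0 \<Longrightarrow> \<exists>g\<in>D. \<forall>x. \<bar>f x - g x\<bar> \<le> e"
    by (rule countable_dense_continuous[OF compact]) blast
  have S: "ergodic_support T = regular_points D"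
    by (rule antisym[OF ergodic_support_subset_regular_points regular_points_subset_ergodic_support])
      (use D dense in auto)
  have fM: "f \<in> borel_measurable \<mu>" if "f \<in> D" for f
    using borel_measurable_continuous_onI[OF D(2)[OF that]] by measurable
  have "(\<Inter>f\<in>D. {x \<in> space \<mu>. convergent (\<lambda>n. birkhoff_average T f n x) \<and>
    (\<forall>j. \<exists>m. birkhoff_limit T (\<lambda>y. (birkhoff_average T f (Suc m) y)\<^sup>2) x <
      (birkhoff_limit T f x)\<^sup>2 + 1 / real (Suc j))}) \<in> sets \<mu>"
  proof (rule sets.countable_INT''[OF _ D(1)])
    show "UNIV \<in> sets \<mu>" by (simp add: sets)
    fix f assume "f \<in> D"
    note f = fM[OF this]
    show "{x \<in> space \<mu>. convergent (\<lambda>n. birkhoff_average T f n x) \<and>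
      (\<forall>j. \<exists>m. birkhoff_limit T (\<lambda>y. (birkhoff_average T f (Suc m) y)\<^sup>2) x <
        (birkhoff_limit T f x)\<^sup>2 + 1 / real (Suc j))} \<in> sets \<mu>"
      \<comment> \<open>Convergence is restated as the Cauchy property, which mentions no limit and
        is measurable by countably many operations.\<close>
      unfolding Cauchy_convergent_iff[symmetric]
      by (intro sets.sets_Collect_conj sets.sets_Collect_countable_All sets.sets_Collect_countable_Ex
        sets_Collect_Cauchy borel_measurable_less borel_measurable_add borel_measurable_power
        borel_measurable_const birkhoff_average_measurable birkhoff_limit_measurable f)
  qed
  also have "(\<Inter>f\<in>D. {x \<in> space \<mu>. convergent (\<lambda>n. birkhoff_average T f n x) \<and>
    (\<forall>j. \<exists>m. birkhoff_limit T (\<lambda>y. (birkhoff_average T f (Suc m) y)\<^sup>2) x <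
      (birkhoff_limit T f x)\<^sup>2 + 1 / real (Suc j))}) = regular_points D"
    by (auto simp: regular_points_def space)
  finally have "regular_points D \<in> sets \<mu>" .
  moreover have "AE x in \<mu>. x \<in> regular_points D"
    unfolding regular_points_def mem_Collect_eq
  proof (rule AE_ball_countable'[OF _ D(1)])
    fix f assume f: "f \<in> D"
    obtain B where B: "\<And>y. \<bar>f y\<bar> \<le> B" using continuous_bounded[OF compact D(2)[OF f]] by blast
    have "AE x in \<mu>. \<forall>j. \<exists>m. birkhoff_limit T (\<lambda>y. (birkhoff_average T f (Suc m) y)\<^sup>2) x <
        (birkhoff_limit T f x)\<^sup>2 + 1 / real (Suc j)"
      unfolding AE_all_countable by (intro allI AE_birkhoff_limit_square_less[OF fM[OF f] B]) simp
    with birkhoff(1)[OF fM[OF f] B]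
    show "AE x in \<mu>. convergent (\<lambda>n. birkhoff_average T f n x) \<and>
      (\<forall>j. \<exists>m. birkhoff_limit T (\<lambda>y. (birkhoff_average T f (Suc m) y)\<^sup>2) x <
        (birkhoff_limit T f x)\<^sup>2 + 1 / real (Suc j))"
      by eventually_elim (auto intro: convergentI)
  qed
  ultimately show ?thesis
    unfolding S by (intro emeasure_eq_1_AE)
qed

end

theorem theorem4:
  fixes T :: "'a::metric_space \<Rightarrow> 'a" and \<mu> :: "'a measure"
  assumes "compact (UNIV :: 'a set)"
    and "continuous_on UNIV T"
    and "\<mu> \<in> invariant_measures T"
  shows "emeasure \<mu> (ergodic_support T) = 1"
  using assms by (intro compact_system.emeasure_ergodic_support compact_system.intro)

end
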